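(* Let $\epsilon \in (0, 2/5]$ and $C > 0$. Then there exists $p_0(\epsilon, C)>0$ such that the following holds. Let $\psi, \theta: \mathbb N\to\mathbb R_{\geq0}$ be finitely supported, $V_{\psi} = \operatorname{supp}\psi$, $W_\theta = \operatorname{supp}\theta$, and let $\mathcal P_{\psi,\theta} = \{ p \text{ prime}: \exists(v,w)\in V_{\psi}\times W_{\theta} \text{ with } p\mid vw \}$ and $P_{\psi, \theta}(\epsilon,C) = p_0(\epsilon, C) + \lvert \mathcal P_{\psi, \theta}\cap [1, p_0(\epsilon, C)]\rvert$. Let $f, g:\mathbb N\to\mathbb R_{\geq 0}$ be multiplicative functions with $(1\star f)(n)\leq n$ and $(1\star g)(n)\leq n$ for all $n\geq 1$. Let $V,W\subseteq \mathbb N$, $t\geq 1$, $K\in\mathbb R$, and suppose $\mathcal E \subset \mathcal E_{\psi,\theta}^{t, K}\cap(V\times W)$. Then $$\mu_{\psi,\theta}^{f,g}(\mathcal E) \leq (100e^{C})^{P_{\psi,\theta}(\epsilon, C)}(\operatorname{Log} t)^{\frac{1}{2}(e^{40C}-1)}\big(\mu_{\psi}^{f}(V)\mu_{\theta}^{g}(W)e^{-CK}\big)^{\frac{1}{2}+\epsilon}.$$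
   Context: Primes are denoted $p$. For $v,w\in\mathbb N$ and real $t\geq1$, $\omega_t(v,w) = \lvert\{ p\leq t : p\mid \frac{vw}{\gcd(v,w)^2}\}\rvert$. For $\psi,\theta:\mathbb N\to\mathbb R_{\ge0}$, $D_{\psi,\theta}(v,w) = \frac{\max(w\psi(v),v\theta(w))}{\gcd(v,w)}$. For $f:\mathbb N\to\mathbb R_{\ge0}$ and $v\in\mathbb N$, $\mu_\psi^f(v)=\frac{f(v)\psi(v)}{v}$; for $V\subseteq\mathbb N$, $\mu_\psi^f(V)=\sum_{v\in V}\mu_\psi^f(v)$; for $\mathcal E\subseteq\mathbb N\times\mathbb N$, $\mu_{\psi,\theta}^{f,g}(\mathcal E)=\sum_{(v,w)\in\mathcal E}\mu_\psi^f(v)\mu_\theta^g(w)$. With $V_\psi=\operatorname{supp}\psi$, $W_\theta=\operatorname{supp}\theta$, $t\ge1$, $K\in\mathbb R$: $\mathcal E_{\psi,\theta}^{t,K}=\{(v,w)\in V_\psi\times W_\theta : D_{\psi,\theta}(v,w)\le 1,\ \omega_t(v,w)\ge K\}$. $(1\star f)(n)=\sum_{d\mid n} f(d)$ is Dirichlet convolution. $\operatorname{Log} t=\max\{1,\log t\}$. *)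

theory Defs
  imports "HOL-Analysis.Analysis" "HOL-Computational_Algebra.Primes"
begin

text \<open>Throughout, \<open>\<nat>\<close> in the paper means the positive integers; index 0 is excluded.\<close>

definition multiplicative :: "(nat \<Rightarrow> real) \<Rightarrow> bool" where
  "multiplicative f \<longleftrightarrow> f 1 = 1 \<and>
     (\<forall>m n. m \<ge> 1 \<longrightarrow> n \<ge> 1 \<longrightarrow> coprime m n \<longrightarrow> f (m * n) = f m * f n)"

definition dconv1 :: "(nat \<Rightarrow> real) \<Rightarrow> nat \<Rightarrow> real" where
  "dconv1 f n = (\<Sum>d\<in>{d. d dvd n}. f d)"

definition supp_nat :: "(nat \<Rightarrow> real) \<Rightarrow> nat set" where
  "supp_nat \<psi> = {v. v \<ge> 1 \<and> \<psi> v \<noteq> 0}"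

definition omega_t :: "real \<Rightarrow> nat \<Rightarrow> nat \<Rightarrow> nat" where
  "omega_t t v w = card {p. prime p \<and> real p \<le> t \<and> p dvd ((v * w) div (gcd v w)^2)}"

definition Dpt :: "(nat \<Rightarrow> real) \<Rightarrow> (nat \<Rightarrow> real) \<Rightarrow> nat \<Rightarrow> nat \<Rightarrow> real" where
  "Dpt \<psi> \<theta> v w = max (real w * \<psi> v) (real v * \<theta> w) / real (gcd v w)"

definition mu1 :: "(nat \<Rightarrow> real) \<Rightarrow> (nat \<Rightarrow> real) \<Rightarrow> nat \<Rightarrow> real" where
  "mu1 f \<psi> v = f v * \<psi> v / real v"

definition muset :: "(nat \<Rightarrow> real) \<Rightarrow> (nat \<Rightarrow> real) \<Rightarrow> nat set \<Rightarrow> real" where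
  "muset f \<psi> V = infsum (mu1 f \<psi>) V"

definition mupair :: "(nat \<Rightarrow> real) \<Rightarrow> (nat \<Rightarrow> real) \<Rightarrow> (nat \<Rightarrow> real) \<Rightarrow> (nat \<Rightarrow> real)
    \<Rightarrow> (nat \<times> nat) set \<Rightarrow> real" where
  "mupair f g \<psi> \<theta> E = infsum (\<lambda>(v, w). mu1 f \<psi> v * mu1 g \<theta> w) E"

definition Eset :: "(nat \<Rightarrow> real) \<Rightarrow> (nat \<Rightarrow> real) \<Rightarrow> real \<Rightarrow> real \<Rightarrow> (nat \<times> nat) set" where
  "Eset \<psi> \<theta> t K = {(v, w). v \<in> supp_nat \<psi> \<and> w \<in> supp_nat \<theta> \<and>
      Dpt \<psi> \<theta> v w \<le> 1 \<and> real (omega_t t v w) \<ge> K}"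

definition Pset :: "(nat \<Rightarrow> real) \<Rightarrow> (nat \<Rightarrow> real) \<Rightarrow> nat set" where
  "Pset \<psi> \<theta> = {p. prime p \<and> (\<exists>v\<in>supp_nat \<psi>. \<exists>w\<in>supp_nat \<theta>. p dvd v * w)}"

definition Logt :: "real \<Rightarrow> real" where
  "Logt t = max 1 (ln t)"

end

theory Submission
  imports Defs
begin

text \<open>
  Write \<open>\<kappa> = 1/2 + \<epsilon>\<close>. The argument is an induction on the set of primes dividing the vertices.
  For a prime \<open>p\<close>, split the vertices into the classes with \<open>p\<^sup>i\<close> exactly dividing \<open>v\<close> and \<open>p\<^sup>j\<close> exactly
  dividing \<open>w\<close>; dividing these powers out and rescaling \<open>\<psi>\<close>, \<open>\<theta>\<close> gives a system without \<open>p\<close>, so the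
  induction hypothesis bounds the class \<open>(i, j)\<close> with a gain \<open>p\<close> to the power \<open>-(1 - \<kappa>) |i - j|\<close>, at
  the price of \<open>exp (C \<kappa>)\<close> if \<open>i \<noteq> j\<close>. Summing over the classes costs a factor \<open>100 exp C\<close>, which is
  allowed for \<open>p \<le> p\<^sub>0\<close>. Since \<open>2 \<kappa> > 1\<close>, for large \<open>p\<close> the sum loses nothing unless both measures are
  concentrated, up to \<open>O(1/p)\<close>, on a common exponent \<open>k p\<close>; and in that case the edges with both
  exponents different from \<open>k p\<close> have relative measure \<open>O(p powr - 2 \<kappa>)\<close>, which is summable over \<open>p\<close>.

  It remains to treat systems in which for every \<open>p\<close> each edge has \<open>v\<close> or \<open>w\<close> at the exponent \<open>k p\<close>.
  Put \<open>N = \<Prod>p. p ^ k p\<close> and \<open>v = N v\<^sub>+ / v\<^sub>-\<close> in lowest terms. Then \<open>D \<le> 1\<close> reads \<open>a v * w\<^sub>+ \<le> 1\<close> and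
  \<open>b w * v\<^sub>+ \<le> 1\<close> with \<open>a v = \<psi> v * v\<^sub>-\<close>, \<open>b w = \<theta> w * w\<^sub>-\<close>. Splitting the edges according to which of
  \<open>a v\<close>, \<open>\<tau> * b w\<close> is larger, each half is summed over one endpoint: there are at most \<open>1 / b w\<close> values
  of \<open>v\<^sub>+\<close>, and the sum over \<open>v\<^sub>-\<close> is controlled by \<open>1 \<star> f \<le> id\<close>. This gives the exponent \<open>1/2\<close>; the
  condition on \<open>\<omega>\<^sub>t\<close> enters by Rankin's trick and produces the power of \<open>Log t\<close>. If the total
  measure is below \<open>1\<close>, interpolation with the trivial bound yields the exponent \<open>\<kappa>\<close>.
\<close>

section \<open>Inequalities for bilinear sums over pairs of exponents\<close>

section \<open>Weighted sums over exponent classes\<close>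

text \<open>Bernoulli's inequality, as weighted AM-GM for the positive numbers \<open>1 - z\<close>
  and \<open>1\<close>; hence \<open>z = 1\<close> is split off.\<close>

lemma powr_one_minus_le:
  fixes z a :: real
  assumes "0 \<le> z" "z \<le> 1" "0 \<le> a" "a \<le> 1"
  shows "(1 - z) powr a \<le> 1 - a * z"
proof (cases "z = 1")
  case True
  then show ?thesis using assms by auto
next
  case False
  then have "(1 - z) powr a * 1 powr (1 - a) \<le> a * (1 - z) + (1 - a) * 1"
    using assms by (intro Youngs_inequality_0) auto
  then show ?thesis by (simp add: algebra_simps)
qed

text \<open>The bound is linear in \<open>a\<close> and in \<open>b\<close>, so it can be summed
  over classes. The product of the shares \<open>a / A\<close> and \<open>b / B\<close> lies in
  \<open>[0, 1]\<close>, where lowering the exponent from \<kappa> to \<open>1/2\<close> only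
  increases the power; then AM-GM applies.\<close>

lemma powr_mult_le_mean:
  fixes a b A B \<kappa> :: real
  assumes "0 \<le> a" "a \<le> A" "0 \<le> b" "b \<le> B" "0 < A" "0 < B" "1/2 \<le> \<kappa>"
  shows "(a * b) powr \<kappa> \<le> (A * B) powr \<kappa> * (a / A + b / B) / 2"
proof -
  have u: "0 \<le> a / A" "a / A \<le> 1" "0 \<le> b / B" "b / B \<le> 1" using assms by auto
  have uv: "0 \<le> (a / A) * (b / B)" "(a / A) * (b / B) \<le> 1"
    using mult_nonneg_nonneg[OF u(1,3)] mult_le_one[OF u(2,3,4)] by blast+
  have "(a * b) powr \<kappa> = (A * B) powr \<kappa> * ((a / A) * (b / B)) powr \<kappa>"
    using assms uv by (subst powr_mult[symmetric]) auto
  also have "\<dots> \<le> (A * B) powr \<kappa> * ((a / A) * (b / B)) powr (1/2)"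
    using uv assms by (intro mult_left_mono powr_mono') auto
  also have "((a / A) * (b / B)) powr (1/2) \<le> (a / A + b / B) / 2"
    using arith_geo_mean_sqrt[of "a/A" "b/B"] u uv by (simp add: powr_half_sqrt)
  finally show ?thesis by (simp add: mult_left_mono)
qed

text \<open>Each term is at most the mean of two shares, and the shares of either kind total at most
  \<open>1\<close>. Equal exponents therefore cost no constant.\<close>

lemma sum_diag_powr_le:
  fixes \<alpha> \<beta> :: "nat \<Rightarrow> real"
  assumes "finite I" "finite J" "\<And>i. 0 \<le> \<alpha> i" "\<And>i. 0 \<le> \<beta> i" "1/2 \<le> \<kappa>"
  shows "(\<Sum>i\<in>I \<inter> J. (\<alpha> i * \<beta> i) powr \<kappa>) \<le> (sum \<alpha> I * sum \<beta> J) powr \<kappa>"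
proof (cases "sum \<alpha> I = 0 \<or> sum \<beta> J = 0")
  case True
  then have "\<alpha> i * \<beta> i = 0" if "i \<in> I \<inter> J" for i
    using that assms by (auto simp: sum_nonneg_eq_0_iff)
  then have "(\<Sum>i\<in>I \<inter> J. (\<alpha> i * \<beta> i) powr \<kappa>) = 0"
    by (intro sum.neutral ballI) auto
  then show ?thesis by simp
next
  case False
  define A where "A = sum \<alpha> I"
  define B where "B = sum \<beta> J"
  have pos: "0 < A" "0 < B" using False assms by (auto simp: A_def B_def less_le sum_nonneg)
  have "(\<Sum>i\<in>I \<inter> J. (\<alpha> i * \<beta> i) powr \<kappa>)
      \<le> (\<Sum>i\<in>I \<inter> J. (A * B) powr \<kappa> * (\<alpha> i / A + \<beta> i / B) / 2)"
    using assms pos unfolding A_def B_def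
    by (intro sum_mono powr_mult_le_mean member_le_sum) auto
  also have "\<dots> = (A * B) powr \<kappa> * (sum \<alpha> (I \<inter> J) / A + sum \<beta> (I \<inter> J) / B) / 2"
    by (simp add: sum_distrib_left sum_divide_distrib sum.distrib add_divide_distrib distrib_left)
  also have "\<dots> \<le> (A * B) powr \<kappa> * (A / A + B / B) / 2"
    using assms pos unfolding A_def B_def
    by (intro divide_right_mono mult_left_mono add_mono sum_mono2) auto
  also have "\<dots> = (A * B) powr \<kappa>" using pos by simp
  finally show ?thesis by (simp add: A_def B_def)
qed

text \<open>Each distance \<open>r >= 1\<close> occurs at most once on either side of
  \<open>i\<close>, so two geometric series starting at \<open>q\<close> dominate the sum.\<close>

lemma sum_powers_dist_le:
  fixes q :: real
  assumes "0 < q" "q < 1" "finite J"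
  shows "(\<Sum>j\<in>J - {i}. q ^ (i - j + (j - i))) \<le> 2 * q / (1 - q)"
proof -
  have geo: "(\<Sum>r\<in>R. q ^ r) \<le> q / (1 - q)" if R: "finite R" "0 \<notin> R" for R
  proof -
    have "(\<Sum>r\<in>R. q ^ r) = (\<Sum>r\<in>(\<lambda>r. r - 1) ` R. q ^ Suc r)"
    proof (subst sum.reindex)
      show "inj_on (\<lambda>r. r - 1) R"
      proof (rule inj_onI)
        fix x y assume "x \<in> R" "y \<in> R" "x - 1 = y - 1"
        then show "x = y" using R by (cases x; cases y) auto
      qed
      show "(\<Sum>r\<in>R. q ^ r) = sum ((\<lambda>r. q ^ Suc r) \<circ> (\<lambda>r. r - 1)) R"
      proof (rule sum.cong)
        fix x assume "x \<in> R"
        then show "q ^ x = ((\<lambda>r. q ^ Suc r) \<circ> (\<lambda>r. r - 1)) x" using R by (cases x) auto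
      qed simp
    qed
    also have "\<dots> \<le> (\<Sum>r. q ^ Suc r)"
      using assms R summable_geometric[of q] summable_Suc_iff[of "\<lambda>n. q ^ n"]
      by (intro sum_le_suminf) auto
    also have "\<dots> = q / (1 - q)"
      using assms suminf_mult[of "\<lambda>n. q ^ n" q] suminf_geometric[of q] summable_geometric[of q]
      by simp
    finally show ?thesis .
  qed
  have "(\<Sum>j\<in>J - {i}. q ^ (i - j + (j - i)))
      = (\<Sum>j\<in>{j\<in>J. j < i}. q ^ (i - j + (j - i))) + (\<Sum>j\<in>{j\<in>J. i < j}. q ^ (i - j + (j - i)))"
    using assms by (subst sum.union_disjoint[symmetric]) (auto intro!: sum.cong)
  also have "(\<Sum>j\<in>{j\<in>J. j < i}. q ^ (i - j + (j - i))) = (\<Sum>r\<in>(\<lambda>j. i - j) ` {j\<in>J. j < i}. q ^ r)"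
    by (subst sum.reindex) (auto simp: inj_on_def)
  also have "\<dots> \<le> q / (1 - q)" using assms by (intro geo) auto
  also have "(\<Sum>j\<in>{j\<in>J. i < j}. q ^ (i - j + (j - i))) = (\<Sum>r\<in>(\<lambda>j. j - i) ` {j\<in>J. i < j}. q ^ r)"
    by (subst sum.reindex) (auto simp: inj_on_def)
  also have "\<dots> \<le> q / (1 - q)" using assms by (intro geo) auto
  finally show ?thesis by simp
qed

text \<open>A Schur test: after linearising the power, the kernel \<open>q ^ |i - j|\<close> enters
  only through its row and column sums off the diagonal.\<close>

lemma sum_off_diag_powr_le:
  fixes \<alpha> \<beta> :: "nat \<Rightarrow> real"
  assumes fin: "finite I" "finite J" and nn: "\<And>i. 0 \<le> \<alpha> i" "\<And>i. 0 \<le> \<beta> i" and k: "1/2 \<le> \<kappa>"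
    and q: "0 < q" "q < 1"
  shows "(\<Sum>i\<in>I. \<Sum>j\<in>J - {i}. q ^ (i - j + (j - i)) * (\<alpha> i * \<beta> j) powr \<kappa>)
      \<le> 2 * q / (1 - q) * (sum \<alpha> I * sum \<beta> J) powr \<kappa>"
proof (cases "sum \<alpha> I = 0 \<or> sum \<beta> J = 0")
  case True
  then have "\<alpha> i * \<beta> j = 0" if "i \<in> I" "j \<in> J - {i}" for i j
    using that assms by (auto simp: sum_nonneg_eq_0_iff)
  then have "(\<Sum>i\<in>I. \<Sum>j\<in>J - {i}. q ^ (i - j + (j - i)) * (\<alpha> i * \<beta> j) powr \<kappa>) = 0"
    by (intro sum.neutral ballI) auto
  then show ?thesis using True by auto
next
  case False
  define A where "A = sum \<alpha> I"
  define B where "B = sum \<beta> J"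
  define G where "G = 2 * q / (1 - q)"
  have pos: "0 < A" "0 < B" using False assms by (auto simp: A_def B_def less_le sum_nonneg)
  let ?d = "\<lambda>i j::nat. q ^ (i - j + (j - i))"
  have "(\<Sum>i\<in>I. \<Sum>j\<in>J - {i}. ?d i j * (\<alpha> i * \<beta> j) powr \<kappa>)
      \<le> (\<Sum>i\<in>I. \<Sum>j\<in>J - {i}. ?d i j * ((A * B) powr \<kappa> * (\<alpha> i / A + \<beta> j / B) / 2))"
    using assms pos unfolding A_def B_def
    by (intro sum_mono mult_left_mono powr_mult_le_mean member_le_sum) auto
  also have "\<dots> = (A * B) powr \<kappa> / 2 *
      ((\<Sum>i\<in>I. \<Sum>j\<in>J - {i}. ?d i j * (\<alpha> i / A)) + (\<Sum>i\<in>I. \<Sum>j\<in>J - {i}. ?d i j * (\<beta> j / B)))"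
    unfolding sum.distrib[symmetric] sum_distrib_left
    by (intro sum.cong refl) (simp add: algebra_simps)
  also have "(\<Sum>i\<in>I. \<Sum>j\<in>J - {i}. ?d i j * (\<alpha> i / A)) = (\<Sum>i\<in>I. \<alpha> i / A * (\<Sum>j\<in>J - {i}. ?d i j))"
    by (simp add: sum_distrib_left mult.commute)
  also have "\<dots> \<le> (\<Sum>i\<in>I. \<alpha> i / A * G)"
    using sum_powers_dist_le[OF q fin(2)] nn pos unfolding G_def by (intro sum_mono mult_left_mono) auto
  also have "\<dots> = G" using pos by (simp add: sum_distrib_right[symmetric] sum_divide_distrib[symmetric] A_def)
  also have "(\<Sum>i\<in>I. \<Sum>j\<in>J - {i}. ?d i j * (\<beta> j / B)) = (\<Sum>i\<in>I. \<Sum>j\<in>J. if j = i then 0 else ?d i j * (\<beta> j / B))"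
    using fin by (intro sum.cong refl sum.mono_neutral_cong_left) auto
  also have "\<dots> = (\<Sum>j\<in>J. \<Sum>i\<in>I. if j = i then 0 else ?d i j * (\<beta> j / B))" by (rule sum.swap)
  also have "\<dots> = (\<Sum>j\<in>J. \<Sum>i\<in>I - {j}. ?d i j * (\<beta> j / B))"
    using fin by (intro sum.cong refl sum.mono_neutral_cong_right) auto
  also have "\<dots> = (\<Sum>j\<in>J. \<beta> j / B * (\<Sum>i\<in>I - {j}. ?d j i))"
    by (simp add: sum_distrib_left mult.commute add.commute)
  also have "\<dots> \<le> (\<Sum>j\<in>J. \<beta> j / B * G)"
    using sum_powers_dist_le[OF q fin(1)] nn pos unfolding G_def by (intro sum_mono mult_left_mono) auto
  also have "\<dots> = G" using pos by (simp add: sum_distrib_right[symmetric] sum_divide_distrib[symmetric] B_def)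
  finally show ?thesis by (simp add: A_def B_def G_def mult_left_mono)
qed

text \<open>The exponent is \<open>|i - j|\<close>: one of the two truncated differences vanishes.\<close>

definition class_weight :: "real \<Rightarrow> real \<Rightarrow> nat \<Rightarrow> nat \<Rightarrow> real" where
  "class_weight L q i j = (if i = j then 1 else L * q ^ (i - j + (j - i)))"

lemma sum_class_weight_le:
  fixes \<alpha> \<beta> :: "nat \<Rightarrow> real"
  assumes "finite I" "finite J" "\<And>i. 0 \<le> \<alpha> i" "\<And>i. 0 \<le> \<beta> i" "1/2 \<le> \<kappa>"
    "0 < q" "q < 1" "0 \<le> L"
  shows "(\<Sum>i\<in>I. \<Sum>j\<in>J. class_weight L q i j * (\<alpha> i * \<beta> j) powr \<kappa>)
      \<le> (\<Sum>i\<in>I \<inter> J. (\<alpha> i * \<beta> i) powr \<kappa>) + L * (2 * q / (1 - q)) * (sum \<alpha> I * sum \<beta> J) powr \<kappa>"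
proof -
  have "(\<Sum>j\<in>J. class_weight L q i j * (\<alpha> i * \<beta> j) powr \<kappa>)
     = (if i \<in> J then (\<alpha> i * \<beta> i) powr \<kappa> else 0)
       + L * (\<Sum>j\<in>J - {i}. q ^ (i - j + (j - i)) * (\<alpha> i * \<beta> j) powr \<kappa>)" for i
  proof -
    have "(\<Sum>j\<in>J - {i}. class_weight L q i j * (\<alpha> i * \<beta> j) powr \<kappa>)
        = L * (\<Sum>j\<in>J - {i}. q ^ (i - j + (j - i)) * (\<alpha> i * \<beta> j) powr \<kappa>)"
      unfolding sum_distrib_left by (intro sum.cong) (auto simp: class_weight_def)
    moreover have "class_weight L q i i = 1" by (simp add: class_weight_def)
    ultimately show ?thesis
      using sum.remove[OF assms(2), of i "\<lambda>j. class_weight L q i j * (\<alpha> i * \<beta> j) powr \<kappa>"]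
      by (cases "i \<in> J") simp_all
  qed
  then have "(\<Sum>i\<in>I. \<Sum>j\<in>J. class_weight L q i j * (\<alpha> i * \<beta> j) powr \<kappa>)
     = (\<Sum>i\<in>I \<inter> J. (\<alpha> i * \<beta> i) powr \<kappa>)
       + L * (\<Sum>i\<in>I. \<Sum>j\<in>J - {i}. q ^ (i - j + (j - i)) * (\<alpha> i * \<beta> j) powr \<kappa>)"
    using assms by (simp add: sum.distrib sum_distrib_left sum.inter_restrict)
  then show ?thesis
    using mult_left_mono[OF sum_off_diag_powr_le[of I J \<alpha> \<beta> \<kappa> q], of L] assms
    by (simp add: mult_ac)
qed

lemma sum_class_weight_le':
  fixes \<alpha> \<beta> :: "nat \<Rightarrow> real"
  assumes "finite I" "finite J" "\<And>i. 0 \<le> \<alpha> i" "\<And>i. 0 \<le> \<beta> i" "1/2 \<le> \<kappa>"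
    "0 < q" "q < 1" "0 \<le> L"
  shows "(\<Sum>i\<in>I. \<Sum>j\<in>J. class_weight L q i j * (\<alpha> i * \<beta> j) powr \<kappa>)
      \<le> (1 + L * (2 * q / (1 - q))) * (sum \<alpha> I * sum \<beta> J) powr \<kappa>"
  using sum_class_weight_le[of I J \<alpha> \<beta> \<kappa> q L] sum_diag_powr_le[of I J \<alpha> \<beta> \<kappa>] assms
  by (simp add: algebra_simps)

text \<open>
  If the sum exceeds \<open>1\<close>, let \<open>k\<close> maximise \<open>\<alpha> k * \<beta> k\<close> and let \<open>z\<close> be the larger of \<open>1 - \<alpha> k\<close>, \<open>1 - \<beta> k\<close>.
  The diagonal is at most \<open>(1 - z) powr \<epsilon>\<close>, which forces \<open>z\<close> to be small; then the diagonal is below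
  \<open>1 - z / 4\<close> while everything off it is \<open>O(L q z powr \<kappa>)\<close>, whence \<open>z powr (1 - \<kappa>) = O(L q)\<close>.
\<close>

lemma sum_class_weight_dichotomy:
  fixes \<alpha> \<beta> :: "nat \<Rightarrow> real"
  assumes I: "finite I" and nn: "\<And>i. 0 \<le> \<alpha> i" "\<And>i. 0 \<le> \<beta> i"
    and one: "sum \<alpha> I = 1" "sum \<beta> I = 1"
    and e: "0 < \<epsilon>" "\<epsilon> < 1/2" and \<kappa>: "\<kappa> = 1/2 + \<epsilon>" and L: "1 \<le> L"
    and q: "0 < q" "4 * L * q \<le> 1" "(4 * L * q / \<epsilon>) powr (2 * \<epsilon>) \<le> 1/4"
  shows "(\<Sum>i\<in>I. \<Sum>j\<in>I. class_weight L q i j * (\<alpha> i * \<beta> j) powr \<kappa>) \<le> 1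
    \<or> (\<exists>k. (\<Sum>i\<in>I - {k}. \<Sum>j\<in>I - {k}. class_weight L q i j * (\<alpha> i * \<beta> j) powr \<kappa>)
            \<le> 2 * (48 * L * q) powr (2 * \<kappa> / (1 - \<kappa>)))"
proof (unfold disj_imp, rule impI)
  define S where "S = (\<lambda>I J. \<Sum>i\<in>I. \<Sum>j\<in>J. class_weight L q i j * (\<alpha> i * \<beta> j) powr \<kappa>)"
  assume "\<not> (\<Sum>i\<in>I. \<Sum>j\<in>I. class_weight L q i j * (\<alpha> i * \<beta> j) powr \<kappa>) \<le> 1"
  then have S1: "S I I > 1" by (simp add: S_def)
  define G where "G = 2 * q / (1 - q)"
  have "q \<le> L * q" using L q by simp
  then have q4: "q \<le> 1/4" using q by linarith
  have k2: "1/2 \<le> \<kappa>" "\<kappa> \<le> 1" "0 < 1 - \<kappa>" using e \<kappa> by auto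
  have "2 * q \<le> 4 * q * (1 - q)" using q4 q mult_left_mono[of "1/2" "1-q" "4*q"] by simp
  then have "G \<le> 4 * q" using q4 unfolding G_def by (simp add: divide_le_eq)
  then have LG: "L * G \<le> 4 * L * q" using L mult_left_mono[of G "4*q" L] by (simp add: mult_ac)
  have G0: "0 < L * G" unfolding G_def using q q4 L by simp
  have cw: "S X Y \<le> (\<Sum>i\<in>X \<inter> Y. (\<alpha> i * \<beta> i) powr \<kappa>) + L * G * (sum \<alpha> X * sum \<beta> Y) powr \<kappa>"
    if "finite X" "finite Y" for X Y
    using sum_class_weight_le[of X Y \<alpha> \<beta> \<kappa> q L] that nn k2 q q4 L unfolding S_def G_def by simp
  have "I \<noteq> {}" using one by auto
  then have "Max ((\<lambda>i. \<alpha> i * \<beta> i) ` I) \<in> (\<lambda>i. \<alpha> i * \<beta> i) ` I" using I by (intro Max_in) auto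
  then obtain k where k1: "k \<in> I" "Max ((\<lambda>i. \<alpha> i * \<beta> i) ` I) = \<alpha> k * \<beta> k" by blast
  have k: "\<alpha> i * \<beta> i \<le> \<alpha> k * \<beta> k" if "i \<in> I" for i
    using k1 Max_ge[of "(\<lambda>i. \<alpha> i * \<beta> i) ` I" "\<alpha> i * \<beta> i"] I that by auto
  define x where "x = sum \<alpha> (I - {k})"
  define y where "y = sum \<beta> (I - {k})"
  define z where "z = max x y"
  have xk: "\<alpha> k = 1 - x" "\<beta> k = 1 - y"
    using one sum.remove[OF I k1(1), of \<alpha>] sum.remove[OF I k1(1), of \<beta>] by (auto simp: x_def y_def)
  have x0: "0 \<le> x" "0 \<le> y" "x \<le> 1" "y \<le> 1"
    using nn[of k] xk sum_nonneg[of "I - {k}" \<alpha>] sum_nonneg[of "I - {k}" \<beta>] nn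
    unfolding x_def y_def by auto
  have z: "0 \<le> z" "z \<le> 1" "x \<le> z" "y \<le> z" using x0 by (auto simp: z_def)
  have "(1 - x) * (1 - y) \<le> 1 - x" "(1 - x) * (1 - y) \<le> 1 - y"
    using x0 by (auto simp: mult_left_le mult_left_le_one_le)
  then have prod_le: "(1 - x) * (1 - y) \<le> 1 - z" by (auto simp: z_def)
  have prod_ge: "0 \<le> (1 - x) * (1 - y)" using x0 by simp
  \<comment> \<open>Exponent \<open>1/2\<close> already makes the diagonal sum at most
    \<open>1\<close>; the surplus \<epsilon> is spent on the largest product, which is at most
    \<open>1 - z\<close>.\<close>
  have diag: "(\<Sum>i\<in>I. (\<alpha> i * \<beta> i) powr \<kappa>) \<le> (1 - z) powr \<epsilon>"
  proof -
    have "(\<Sum>i\<in>I. (\<alpha> i * \<beta> i) powr \<kappa>) = (\<Sum>i\<in>I. (\<alpha> i * \<beta> i) powr (1/2) * (\<alpha> i * \<beta> i) powr \<epsilon>)"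
      by (simp add: \<kappa> powr_add)
    also have "\<dots> \<le> (\<Sum>i\<in>I. (\<alpha> i * \<beta> i) powr (1/2) * (1 - z) powr \<epsilon>)"
    proof (intro sum_mono mult_left_mono powr_mono2)
      fix i assume "i \<in> I"
      then show "\<alpha> i * \<beta> i \<le> 1 - z" using k[of i] prod_le xk by simp
    qed (use nn e in auto)
    also have "\<dots> \<le> 1 * (1 - z) powr \<epsilon>"
      unfolding sum_distrib_right[symmetric]
      using sum_diag_powr_le[OF I I, of \<alpha> \<beta> "1/2"] nn one by (intro mult_right_mono) auto
    finally show ?thesis by simp
  qed
  have "1 < (1 - z) powr \<epsilon> + L * G" using S1 cw[OF I I] diag one by simp
  also have "\<dots> \<le> 1 - \<epsilon> * z + L * G" using powr_one_minus_le[of z \<epsilon>] z e by simp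
  finally have "\<epsilon> * z < 4 * L * q" using LG by simp
  then have "z \<le> 4 * L * q / \<epsilon>" using e by (simp add: field_simps)
  then have "z powr (2 * \<epsilon>) \<le> (4 * L * q / \<epsilon>) powr (2 * \<epsilon>)"
    using z e by (intro powr_mono2) auto
  \<comment> \<open>The diagonal of the block avoiding \<open>k\<close> is at most
    \<open>z powr (2 * \<kappa>)\<close>, hence now at most \<open>z / 4\<close>: half of the gain
    \<open>z / 2\<close> obtained at the class of \<open>k\<close>.\<close>
  then have zz: "z powr (2 * \<epsilon>) \<le> 1/4" using q by simp
  have z2: "z powr (2 * \<kappa>) = z * z powr (2 * \<epsilon>)"
    using z by (simp add: \<kappa> powr_add distrib_left)
  have xyz: "(x * y) powr \<kappa> \<le> z powr (2 * \<kappa>)"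
  proof -
    have "(x * y) powr \<kappa> \<le> (z * z) powr \<kappa>" using x0 z k2 by (intro powr_mono2 mult_mono) auto
    also have "\<dots> = z powr (2 * \<kappa>)" using z by (simp add: powr_mult powr_add[symmetric])
    finally show ?thesis .
  qed
  have both: "S (I - {k}) (I - {k}) \<le> (1 + L * G) * (x * y) powr \<kappa>"
    using cw[of "I - {k}" "I - {k}"] sum_diag_powr_le[of "I - {k}" "I - {k}" \<alpha> \<beta> \<kappa>] I nn k2
    by (simp add: x_def y_def distrib_right)
  have xyk: "(x * y) powr \<kappa> \<le> z powr \<kappa>" "((1 - x) * y) powr \<kappa> \<le> z powr \<kappa>" "(x * (1 - y)) powr \<kappa> \<le> z powr \<kappa>"
  proof -
    have "x * y \<le> z" "(1 - x) * y \<le> z" "x * (1 - y) \<le> z"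
      using x0 z mult_left_le[of y x] mult_left_le_one_le[of y "1-x"] mult_left_le[of "1-y" x] by auto
    then show "(x * y) powr \<kappa> \<le> z powr \<kappa>" "((1 - x) * y) powr \<kappa> \<le> z powr \<kappa>" "(x * (1 - y)) powr \<kappa> \<le> z powr \<kappa>"
      using x0 k2 by (auto intro!: powr_mono2)
  qed
  \<comment> \<open>A row or column through \<open>k\<close> with \<open>k\<close> itself removed
    meets no diagonal class, so only the off-diagonal term survives.\<close>
  have row: "S {k} (I - {k}) \<le> L * G * z powr \<kappa>" "S (I - {k}) {k} \<le> L * G * z powr \<kappa>"
    using cw[of "{k}" "I - {k}"] cw[of "I - {k}" "{k}"] I xk G0
      mult_left_mono[OF xyk(2), of "L * G"] mult_left_mono[OF xyk(3), of "L * G"]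
    unfolding x_def[symmetric] y_def[symmetric] by simp_all
  have "S {k} {k} = ((1 - x) * (1 - y)) powr \<kappa>" by (simp add: S_def class_weight_def xk)
  also have "\<dots> \<le> (1 - z) powr \<kappa>" using prod_le prod_ge k2 by (intro powr_mono2) auto
  also have "\<dots> \<le> 1 - \<kappa> * z" using powr_one_minus_le[of z \<kappa>] z k2 by simp
  also have "\<dots> \<le> 1 - z / 2" using k2 z mult_right_mono[of "1/2" \<kappa> z] by simp
  finally have kk: "S {k} {k} \<le> 1 - z / 2" .
  have "S I I = S {k} {k} + S {k} (I - {k}) + S (I - {k}) {k} + S (I - {k}) (I - {k})"
    unfolding S_def sum.remove[OF I k1(1)] sum.distrib by simp
  also have "S (I - {k}) (I - {k}) \<le> z powr (2 * \<kappa>) + L * G * z powr \<kappa>"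
    using both xyz mult_left_mono[OF xyk(1), of "L * G"] G0 by (simp add: distrib_right)
  finally have "1 < 1 - z / 2 + 3 * (L * G * z powr \<kappa>) + z * z powr (2 * \<epsilon>)"
    using S1 kk row z2 by linarith
  moreover have "z * z powr (2 * \<epsilon>) \<le> z / 4" using zz z mult_left_mono[of _ "1/4" z] by fastforce
  ultimately have z3: "z / 4 < 3 * (L * G * z powr \<kappa>)" by linarith
  have zpos: "0 < z" using z3 z by (cases "z = 0") auto
  have "z = z powr (1 - \<kappa>) * z powr \<kappa>" using zpos by (simp add: powr_add[symmetric])
  then have "z powr (1 - \<kappa>) * z powr \<kappa> < 12 * (L * G) * z powr \<kappa>" using z3 by simp
  then have "z powr (1 - \<kappa>) < 12 * (L * G)" using zpos by simp
  then have "z powr (1 - \<kappa>) \<le> 48 * L * q" using LG by linarith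
  \<comment> \<open>This exponent turns the bound on \<open>z powr (1 - \<kappa>)\<close> into one
    on \<open>z powr (2 * \<kappa>)\<close>; for \<open>q = p powr - (1 - \<kappa>)\<close> the
    result is a multiple of \<open>p powr (- 2 * \<kappa>)\<close>.\<close>
  then have "(z powr (1 - \<kappa>)) powr (2 * \<kappa> / (1 - \<kappa>)) \<le> (48 * L * q) powr (2 * \<kappa> / (1 - \<kappa>))"
    using k2 by (intro powr_mono2) auto
  then have zf: "z powr (2 * \<kappa>) \<le> (48 * L * q) powr (2 * \<kappa> / (1 - \<kappa>))"
    using k2 by (simp add: powr_powr)
  have "S (I - {k}) (I - {k}) \<le> 2 * (x * y) powr \<kappa>"
    using both LG q(2) mult_right_mono[of "1 + L * G" 2 "(x * y) powr \<kappa>"] by simp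
  also have "\<dots> \<le> 2 * (48 * L * q) powr (2 * \<kappa> / (1 - \<kappa>))" using xyz zf by simp
  finally show "\<exists>k. (\<Sum>i\<in>I - {k}. \<Sum>j\<in>I - {k}. class_weight L q i j * (\<alpha> i * \<beta> j) powr \<kappa>)
            \<le> 2 * (48 * L * q) powr (2 * \<kappa> / (1 - \<kappa>))" by (auto simp: S_def)
qed

section \<open>A Mertens-type upper bound by Chebyshev's method, and averages of divisor
  weights\<close>

section \<open>Sums over primes\<close>

lemma prod_primes_dvd:
  fixes n :: nat
  assumes "finite S" "\<And>p. p \<in> S \<Longrightarrow> prime p \<and> p dvd n"
  shows "\<Prod>S dvd n"
  using assms
proof (induction S rule: finite_induct)
  case (insert p S)
  have "coprime p (\<Prod>S)"
    using insert by (intro prod_coprime_right) (auto intro: primes_coprime)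
  then show ?case using insert by (auto intro: divides_mult)
qed simp

text \<open>Chebyshev's argument: a prime in \<open>(n, 2 * n]\<close> divides
  \<open>fact (2 * n)\<close> but not \<open>fact n\<close>, hence divides the central binomial
  coefficient.\<close>

lemma prod_primes_between_le: "\<Prod>{p. prime p \<and> n < p \<and> p \<le> 2 * n} \<le> (4::nat) ^ n"
proof -
  have "p dvd (2 * n choose n)" if p: "prime p" "n < p" "p \<le> 2 * n" for p
  proof -
    have "p dvd fact (2 * n)" using p by (simp add: prime_dvd_fact_iff)
    also have "fact (2 * n) = fact n * fact n * (2 * n choose n)"
      using binomial_fact_lemma[of n "2 * n"] by (simp add: mult_2)
    finally show ?thesis using p by (auto simp: prime_dvd_mult_iff prime_dvd_fact_iff)
  qed
  then have "\<Prod>{p. prime p \<and> n < p \<and> p \<le> 2 * n} dvd (2 * n choose n)"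
    by (intro prod_primes_dvd) auto
  then have "\<Prod>{p. prime p \<and> n < p \<and> p \<le> 2 * n} \<le> (2 * n choose n)"
    by (intro dvd_imp_le) auto
  also have "\<dots> \<le> 2 ^ (2 * n)" by (rule binomial_le_pow2)
  finally show ?thesis by (simp add: power_mult)
qed

text \<open>The product of the primes in the block is at least \<open>2 ^ k\<close> to their number
  and at most \<open>4 ^ (2 ^ k)\<close>. So there are at most \<open>2 * 2 ^ k / k\<close> of them,
  each contributing at most \<open>1 / 2 ^ k\<close>.\<close>

lemma sum_inverse_primes_dyadic_le:
  assumes "k \<ge> 1"
  shows "(\<Sum>p | prime p \<and> 2 ^ k < p \<and> p \<le> 2 ^ (k + 1). 1 / real p) \<le> 2 / real k"
proof -
  define S where "S = {p::nat. prime p \<and> 2 ^ k < p \<and> p \<le> 2 ^ (k + 1)}"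
  have fin: "finite S" unfolding S_def by (rule finite_subset[of _ "{..2 ^ (k + 1)}"]) auto
  have "(2::nat) ^ (k * card S) = (\<Prod>p\<in>S. 2 ^ k)" by (simp add: power_mult)
  also have "\<dots> \<le> \<Prod>S" by (intro prod_mono) (auto simp: S_def)
  also have "\<dots> \<le> 4 ^ (2 ^ k)" using prod_primes_between_le[of "2 ^ k"] by (simp add: S_def)
  also have "\<dots> = 2 ^ (2 * 2 ^ k)" by (simp add: power_mult)
  finally have "k * card S \<le> 2 * 2 ^ k" by (rule power_le_imp_le_exp[rotated]) simp
  then have "real (k * card S) \<le> real (2 * 2 ^ k)" by (simp only: of_nat_le_iff)
  then have c: "real k * real (card S) \<le> 2 * 2 ^ k" by simp
  have "(\<Sum>p\<in>S. 1 / real p) \<le> (\<Sum>p\<in>S. 1 / 2 ^ k)"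
  proof (intro sum_mono divide_left_mono)
    fix p assume "p \<in> S"
    then have "2 ^ k < p" by (simp add: S_def)
    then have "real (2 ^ k) \<le> real p" by (simp only: of_nat_le_iff less_imp_le)
    then show "2 ^ k \<le> real p" by simp
    from \<open>2 ^ k < p\<close> have "0 < p" by (rule le_less_trans[OF le0])
    then show "0 < real p * 2 ^ k" by simp
  qed simp
  also have "\<dots> \<le> 2 / real k" using c assms by (simp add: field_simps)
  finally show ?thesis by (simp add: S_def)
qed

lemma sum_inverse_primes_pow2_le:
  "(\<Sum>p | prime p \<and> p \<le> 2 ^ (m + 1). 1 / real p) \<le> 1 / 2 + 2 * harm m"
proof (induction m)
  case 0
  have "{p::nat. prime p \<and> p \<le> 2} = {2}" by (auto dest: prime_ge_2_nat)
  then show ?case by (simp add: harm_def)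
next
  case (Suc m)
  have "{p::nat. prime p \<and> p \<le> 2 ^ (Suc m + 1)} = {p. prime p \<and> p \<le> 2 ^ (m + 1)}
      \<union> {p. prime p \<and> 2 ^ Suc m < p \<and> p \<le> 2 ^ (Suc m + 1)}" by auto
  then have "(\<Sum>p | prime p \<and> p \<le> 2 ^ (Suc m + 1). 1 / real p)
     = (\<Sum>p | prime p \<and> p \<le> 2 ^ (m + 1). 1 / real p)
      + (\<Sum>p | prime p \<and> 2 ^ Suc m < p \<and> p \<le> 2 ^ (Suc m + 1). 1 / real p)"
    by (simp only:) (subst sum.union_disjoint; auto)
  also have "\<dots> \<le> 1 / 2 + 2 * harm m + 2 / real (Suc m)"
    using Suc.IH sum_inverse_primes_dyadic_le[of "Suc m"] by (intro add_mono) auto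
  also have "harm (Suc m) = harm m + 1 / real (Suc m)" by (simp add: harm_Suc inverse_eq_divide)
  then have "1 / 2 + 2 * harm m + 2 / real (Suc m) = 1 / 2 + 2 * harm (Suc m)" by simp
  finally show ?case .
qed

lemma harm_le_ln: "m \<ge> 1 \<Longrightarrow> harm m \<le> 1 + ln (real m)"
proof (induction m rule: nat_induct_at_least)
  case base
  then show ?case by (simp add: harm_def)
next
  case (Suc m)
  have "ln (1 - 1 / real (Suc m)) \<le> - (1 / real (Suc m))"
    using ln_le_minus_one[of "1 - 1 / real (Suc m)"] Suc by (simp add: field_simps)
  also have "1 - 1 / real (Suc m) = real m / real (Suc m)" by (simp add: field_simps)
  also have "ln \<dots> = ln (real m) - ln (real (Suc m))" using Suc.hyps by (simp add: ln_div)
  finally have "inverse (real (Suc m)) \<le> ln (real (Suc m)) - ln (real m)" by (simp add: divide_inverse)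
  then show ?case using Suc by (simp add: harm_Suc)
qed

text \<open>The upper half of Mertens' second theorem with the crude leading constant
  \<open>2\<close>; the \<open>40\<close> in the final exponent leaves room for it.\<close>

lemma sum_inverse_primes_le:
  assumes "t \<ge> 1"
  shows "(\<Sum>p | prime p \<and> real p \<le> t. 1 / real p) \<le> 2 * ln (Logt t) + 5"
proof -
  define m where "m = nat \<lfloor>log 2 t\<rfloor>"
  have log0: "0 \<le> log 2 t" using assms by simp
  have "log 2 t < real (m + 1)" unfolding m_def using log0 by linarith
  then have "t < 2 powr real (m + 1)" using assms by (simp add: log_less_iff)
  then have t: "t < 2 ^ (m + 1)" by (simp only: powr_realpow)
  have "(\<Sum>p | prime p \<and> real p \<le> t. 1 / real p) \<le> (\<Sum>p | prime p \<and> p \<le> 2 ^ (m + 1). 1 / real p)"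
  proof (rule sum_mono2)
    show "finite {p::nat. prime p \<and> p \<le> 2 ^ (m + 1)}" by simp
    show "{p. prime p \<and> real p \<le> t} \<subseteq> {p. prime p \<and> p \<le> 2 ^ (m + 1)}"
    proof safe
      fix p :: nat assume "real p \<le> t"
      then have "real p \<le> real (2 ^ (m + 1))" using t by simp
      then show "p \<le> 2 ^ (m + 1)" by (simp only: of_nat_le_iff)
    qed
  qed simp
  also have "\<dots> \<le> 1 / 2 + 2 * harm m" by (rule sum_inverse_primes_pow2_le)
  also have "harm m \<le> ln (Logt t) + 2"
  proof (cases "m = 0")
    case True
    then show ?thesis by (simp add: harm_def Logt_def)
  next
    case False
    \<comment> \<open>These bounds give \<open>log 2 t <= exp 1 * Logt t\<close>, so leaving base 2
      adds only \<open>1\<close> after the outer logarithm.\<close>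
    have "exp (-1) \<le> (1/2 :: real)" using exp_ge_add_one_self[of 1] by (simp add: exp_minus field_simps)
    also have "1/2 \<le> ln (2::real)" using ln_le_minus_one[of "1/2"] by (simp add: ln_div)
    finally have l2: "exp (-1) \<le> ln (2::real)" .
    have "real m \<le> log 2 t" unfolding m_def using log0 by linarith
    also have "\<dots> = ln t / ln 2" by (simp add: log_def)
    also have "\<dots> \<le> Logt t / exp (-1)"
      using l2 assms by (intro frac_le) (auto simp: Logt_def)
    also have "\<dots> = exp 1 * Logt t" by (simp add: exp_minus field_simps)
    finally have "ln (real m) \<le> ln (exp 1 * Logt t)" using False by simp
    also have "\<dots> = 1 + ln (Logt t)" by (subst ln_mult) (auto simp: Logt_def)
    finally show ?thesis using harm_le_ln[of m] False by simp
  qed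
  finally show ?thesis by simp
qed

text \<open>Write \<open>z p = 1 + (z p - 1)\<close>. The extra weight sits on the multiples
  \<open>p * a\<close> with \<open>a <= X / p\<close>, and the other primes do not notice the factor
  \<open>p\<close>. The induction changes \<open>X\<close>, which is therefore arbitrary.\<close>

lemma sum_prod_weights_le:
  fixes z :: "nat \<Rightarrow> real"
  assumes "finite Q" "\<And>p. p \<in> Q \<Longrightarrow> prime p \<and> 1 \<le> z p" "0 \<le> X"
  shows "(\<Sum>a | 0 < a \<and> real a \<le> X. \<Prod>p\<in>Q. if p dvd a then z p else 1)
      \<le> X * (\<Prod>p\<in>Q. 1 + (z p - 1) / real p)"
  using assms
proof (induction Q arbitrary: X rule: finite_induct)
  case empty
  have "{a. 0 < a \<and> real a \<le> X} \<subseteq> {1..nat \<lfloor>X\<rfloor>}" by (auto simp: le_nat_floor)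
  then have "card {a. 0 < a \<and> real a \<le> X} \<le> nat \<lfloor>X\<rfloor>" using card_mono[of "{1..nat \<lfloor>X\<rfloor>}"] by fastforce
  then have "real (card {a. 0 < a \<and> real a \<le> X}) \<le> X" using empty by linarith
  then show ?case by simp
next
  case (insert p Q)
  have p: "prime p" "1 \<le> z p" "0 < p" using insert by (auto simp: prime_gt_0_nat)
  define F where "F = (\<lambda>a. \<Prod>p\<in>Q. if p dvd a then z p else 1)"
  have fin: "finite {a. 0 < a \<and> real a \<le> X}" for X
    by (rule finite_subset[of _ "{..nat \<lfloor>X\<rfloor>}"]) (auto simp: le_nat_floor)
  have "(\<Sum>a | 0 < a \<and> real a \<le> X. \<Prod>p\<in>insert p Q. if p dvd a then z p else 1)
      = (\<Sum>a | 0 < a \<and> real a \<le> X. F a + (if p dvd a then (z p - 1) * F a else 0))"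
    using insert by (intro sum.cong) (auto simp: F_def algebra_simps)
  also have "\<dots> = (\<Sum>a | 0 < a \<and> real a \<le> X. F a)
      + (z p - 1) * (\<Sum>a\<in>{a. 0 < a \<and> real a \<le> X} \<inter> {a. p dvd a}. F a)"
    using fin[of X] by (simp add: sum.distrib sum.If_cases sum_distrib_left)
  also have "{a. 0 < a \<and> real a \<le> X} \<inter> {a. p dvd a} = (*) p ` {a. 0 < a \<and> real a \<le> X / real p}"
    using p by (auto simp: field_simps elim!: dvdE)
  also have "(\<Sum>a\<in>(*) p ` {a. 0 < a \<and> real a \<le> X / real p}. F a)
      = (\<Sum>a | 0 < a \<and> real a \<le> X / real p. F (p * a))"
    using p by (subst sum.reindex) (auto simp: inj_on_def)
  also have "\<dots> = (\<Sum>a | 0 < a \<and> real a \<le> X / real p. F a)"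
  proof (intro sum.cong refl)
    fix a
    have "q dvd p * a \<longleftrightarrow> q dvd a" if "q \<in> Q" for q
    proof -
      have "prime q" "q \<noteq> p" using that insert by auto
      then show ?thesis using p(1) primes_dvd_imp_eq[of q p] by (auto simp: prime_dvd_mult_iff)
    qed
    then show "F (p * a) = F a" unfolding F_def by (intro prod.cong) auto
  qed
  also have "(\<Sum>a | 0 < a \<and> real a \<le> X. F a) + (z p - 1) * (\<Sum>a | 0 < a \<and> real a \<le> X / real p. F a)
    \<le> X * (\<Prod>p\<in>Q. 1 + (z p - 1) / real p) + (z p - 1) * (X / real p * (\<Prod>p\<in>Q. 1 + (z p - 1) / real p))"
    unfolding F_def using p insert by (intro add_mono mult_left_mono insert.IH) auto
  also have "\<dots> = X * (\<Prod>p\<in>insert p Q. 1 + (z p - 1) / real p)"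
    using insert by (simp add: algebra_simps)
  finally show ?case .
qed

text \<open>By \<open>1 + x <= exp x\<close> the product is governed by the sum of
  \<open>1 / p\<close> over all primes up to \<open>t\<close>, so the bound is independent of
  \<open>P\<close>.\<close>

lemma prod_one_plus_inverse_primes_le:
  assumes "t \<ge> 1" "y \<ge> 1" "finite P" "\<And>p. p \<in> P \<Longrightarrow> prime p"
  shows "(\<Prod>p\<in>P. 1 + ((if real p \<le> t then y else 1) - 1) / real p)
    \<le> exp (5 * (y - 1)) * Logt t powr (2 * (y - 1))"
proof -
  have "(\<Prod>p\<in>P. 1 + ((if real p \<le> t then y else 1) - 1) / real p)
      \<le> (\<Prod>p\<in>P. exp (((if real p \<le> t then y else 1) - 1) / real p))"
    using assms by (intro prod_mono) (auto intro: add_nonneg_nonneg)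
  also have "\<dots> = exp (\<Sum>p\<in>P. ((if real p \<le> t then y else 1) - 1) / real p)"
    using assms by (simp add: exp_sum)
  also have "(\<Sum>p\<in>P. ((if real p \<le> t then y else 1) - 1) / real p)
      = (\<Sum>p\<in>{p\<in>P. real p \<le> t}. (y - 1) * (1 / real p))"
    using assms by (intro sum.mono_neutral_cong_right) auto
  also have "\<dots> \<le> (\<Sum>p | prime p \<and> real p \<le> t. (y - 1) * (1 / real p))"
  proof (rule sum_mono2)
    show "finite {p. prime p \<and> real p \<le> t}"
      by (rule finite_subset[of _ "{..nat \<lfloor>t\<rfloor>}"]) (auto simp: le_nat_floor)
  qed (use assms in auto)
  also have "\<dots> = (y - 1) * (\<Sum>p | prime p \<and> real p \<le> t. 1 / real p)" by (simp add: sum_distrib_left)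
  also have "\<dots> \<le> (y - 1) * (2 * ln (Logt t) + 5)"
    using assms sum_inverse_primes_le by (intro mult_left_mono) auto
  also have "exp \<dots> = exp (5 * (y - 1)) * Logt t powr (2 * (y - 1))"
    by (auto simp: powr_def Logt_def exp_add[symmetric] algebra_simps)
  finally show ?thesis by simp
qed

section \<open>Passing from \<open>P\<close> to \<open>P - {p}\<close> by dividing out powers of
  \<open>p\<close>\<close>

section \<open>Removing one prime\<close>

definition admissible :: "(nat \<Rightarrow> real) \<Rightarrow> bool" where
  "admissible f \<longleftrightarrow> (\<forall>n\<ge>1. 0 \<le> f n) \<and> multiplicative f \<and> (\<forall>n\<ge>1. dconv1 f n \<le> real n)"

text \<open>A prime divides \<open>v w / gcd(v, w)\<^sup>2\<close> iff its multiplicities in \<open>v\<close> and \<open>w\<close> differ.\<close>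

definition gcd_system ::
  "nat set \<Rightarrow> real \<Rightarrow> real \<Rightarrow> (nat \<Rightarrow> real) \<Rightarrow> (nat \<Rightarrow> real) \<Rightarrow> nat set \<Rightarrow> nat set \<Rightarrow> (nat \<times> nat) set \<Rightarrow> bool"
  where
  "gcd_system P t K \<psi> \<theta> V W E \<longleftrightarrow> finite P \<and> (\<forall>p\<in>P. prime p) \<and> finite V \<and> finite W \<and> E \<subseteq> V \<times> W
    \<and> (\<forall>v\<in>V. 0 < v \<and> 0 < \<psi> v \<and> prime_factors v \<subseteq> P)
    \<and> (\<forall>w\<in>W. 0 < w \<and> 0 < \<theta> w \<and> prime_factors w \<subseteq> P)
    \<and> (\<forall>(v, w)\<in>E. real w * \<psi> v \<le> real (gcd v w) \<and> real v * \<theta> w \<le> real (gcd v w)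
        \<and> K \<le> real (card {p \<in> P. real p \<le> t \<and> multiplicity p v \<noteq> multiplicity p w}))"

text \<open>Dividing out a prime rescales \<psi> and \<theta> and may lower \<open>K\<close> by
  \<open>1\<close>, so the bound has to cover all systems on \<open>P\<close> at once for the
  induction to close.\<close>

definition edge_bound ::
  "(nat \<Rightarrow> real) \<Rightarrow> (nat \<Rightarrow> real) \<Rightarrow> real \<Rightarrow> real \<Rightarrow> real \<Rightarrow> nat set \<Rightarrow> real \<Rightarrow> bool" where
  "edge_bound f g t C \<kappa> P B \<longleftrightarrow> (\<forall>\<psi> \<theta> V W E K. gcd_system P t K \<psi> \<theta> V W E \<longrightarrow>
     (\<Sum>(v, w)\<in>E. mu1 f \<psi> v * mu1 g \<theta> w)
       \<le> B * (sum (mu1 f \<psi>) V * sum (mu1 g \<theta>) W * exp (- C * K)) powr \<kappa>)"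

lemma admissible_nonneg: "admissible f \<Longrightarrow> 0 < n \<Longrightarrow> 0 \<le> f n"
  by (auto simp: admissible_def Suc_le_eq)

lemma admissible_one: "admissible f \<Longrightarrow> f 1 = 1"
  by (simp add: admissible_def multiplicative_def)

lemma admissible_mult: "admissible f \<Longrightarrow> 0 < m \<Longrightarrow> 0 < n \<Longrightarrow> coprime m n \<Longrightarrow> f (m * n) = f m * f n"
  by (auto simp: admissible_def multiplicative_def Suc_le_eq)

lemma admissible_sum_divisors_le: "admissible f \<Longrightarrow> 0 < n \<Longrightarrow> (\<Sum>d | d dvd n. f d) \<le> real n"
  by (auto simp: admissible_def dconv1_def Suc_le_eq)

lemma admissible_sum_prime_powers_le:
  assumes "admissible f" "prime p"
  shows "(\<Sum>i\<le>k. f (p ^ i)) \<le> real p ^ k"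
proof -
  have "{d. d dvd p ^ k} = (\<lambda>i. p ^ i) ` {..k}"
    using assms(2) by (auto simp: divides_primepow_nat le_imp_power_dvd)
  moreover have "inj_on (\<lambda>i. p ^ i) {..k}"
    using prime_gt_1_nat[OF assms(2)] by (auto simp: inj_on_def)
  ultimately have "(\<Sum>i\<le>k. f (p ^ i)) = (\<Sum>d | d dvd p ^ k. f d)" by (simp add: sum.reindex)
  then show ?thesis using admissible_sum_divisors_le[OF assms(1), of "p ^ k"] prime_gt_0_nat[OF assms(2)] by simp
qed

lemma admissible_prime_power_le:
  assumes "admissible f" "prime p"
  shows "f (p ^ k) \<le> real p ^ k"
proof -
  have "f (p ^ k) \<le> (\<Sum>i\<le>k. f (p ^ i))"
    using assms by (intro member_le_sum) (auto intro!: admissible_nonneg simp: prime_gt_0_nat)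
  then show ?thesis using admissible_sum_prime_powers_le[OF assms, of k] by linarith
qed

lemma mu1_nonneg: "admissible f \<Longrightarrow> 0 < v \<Longrightarrow> 0 < \<psi> v \<Longrightarrow> 0 \<le> mu1 f \<psi> v"
  by (simp add: mu1_def admissible_nonneg)

lemma gcd_prime_power_mult:
  fixes p v w :: nat
  assumes "prime p" "\<not> p dvd v" "\<not> p dvd w"
  shows "gcd (p ^ i * v) (p ^ j * w) = p ^ min i j * gcd v w"
proof -
  have c: "coprime (p ^ k) v" "coprime (p ^ k) w" for k
    using assms by (auto intro: prime_imp_coprime)
  have 1: "gcd v (p ^ k * w) = gcd v w" for k
    by (rule gcd_mult_right_left_cancel) (rule c(1)[THEN coprime_imp_coprime], auto)
  have 2: "gcd (p ^ k * v) w = gcd v w" for k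
    by (rule gcd_mult_left_left_cancel) (rule c(2)[THEN coprime_imp_coprime], auto)
  show ?thesis
  proof (cases "i \<le> j")
    case True
    then have "p ^ j * w = p ^ i * (p ^ (j - i) * w)" by (simp add: power_add[symmetric] mult.assoc[symmetric])
    then have "gcd (p ^ i * v) (p ^ j * w) = p ^ i * gcd v (p ^ (j - i) * w)"
      by (simp only: gcd_mult_distrib_nat)
    then show ?thesis using True 1 by simp
  next
    case False
    then have "p ^ i * v = p ^ j * (p ^ (i - j) * v)" by (simp add: power_add[symmetric] mult.assoc[symmetric])
    then have "gcd (p ^ i * v) (p ^ j * w) = p ^ j * gcd (p ^ (i - j) * v) w"
      by (simp only: gcd_mult_distrib_nat)
    then show ?thesis using False 2 by simp
  qed
qed

lemma multiplicity_prime_power_mult: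
  fixes p q v :: nat
  assumes "prime p" "prime q" "\<not> p dvd v"
  shows "multiplicity q (p ^ i * v) = (if q = p then i else multiplicity q v)"
proof -
  have "v \<noteq> 0" "p ^ i \<noteq> 0" using assms by (auto intro: ccontr simp: prime_gt_0_nat)
  then have "multiplicity q (p ^ i * v) = multiplicity q (p ^ i) + multiplicity q v"
    using assms by (intro prime_elem_multiplicity_mult_distrib) auto
  then show ?thesis
    using assms by (auto simp: not_dvd_imp_multiplicity_0 multiplicity_distinct_prime_power)
qed

lemma class_eq_image:
  fixes p :: nat
  assumes "prime p" "\<And>v. v \<in> V \<Longrightarrow> 0 < v"
  shows "{v \<in> V. multiplicity p v = i} = (*) (p ^ i) ` {v. \<not> p dvd v \<and> p ^ i * v \<in> V}"
proof (intro equalityI subsetI)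
  fix v assume v: "v \<in> {v \<in> V. multiplicity p v = i}"
  then have "v \<noteq> 0" using assms by auto
  moreover have "\<not> is_unit p" using assms(1) by (auto simp: prime_nat_iff)
  ultimately obtain y where "v = p ^ multiplicity p v * y" "\<not> p dvd y" by (rule multiplicity_decompose')
  then show "v \<in> (*) (p ^ i) ` {v. \<not> p dvd v \<and> p ^ i * v \<in> V}" using v by auto
qed (use assms in \<open>auto simp: multiplicity_prime_power_mult\<close>)

text \<open>Removing \<open>p ^ i\<close> and \<open>p ^ j\<close> takes only
  \<open>p ^ min i j\<close> out of the gcd; the leftover powers of \<open>p\<close> move into the
  weights, so \<open>D <= 1\<close> persists. The edge sum scales by \<open>F * G\<close> but the
  power of the measures only by \<open>(F * G) powr \<kappa>\<close>. As \<open>F * G\<close> is at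
  most \<open>p\<close> to the power \<open>- |i - j|\<close>, the remaining
  \<open>(F * G) powr (1 - \<kappa>)\<close> is the gain.\<close>

lemma edge_class_bound:
  assumes bnd: "edge_bound f g t C \<kappa> (P - {p}) B" and sys: "gcd_system P t K \<psi> \<theta> V W E"
    and p: "prime p" and f: "admissible f" and g: "admissible g"
    and \<kappa>: "0 < \<kappa>" "\<kappa> < 1" and C: "0 < C" and B: "0 \<le> B"
  shows "(\<Sum>(v, w)\<in>{(v, w) \<in> E. multiplicity p v = i \<and> multiplicity p w = j}. mu1 f \<psi> v * mu1 g \<theta> w)
    \<le> B * (class_weight (exp (C * \<kappa>)) (real p powr - (1 - \<kappa>)) i j *
        (sum (mu1 f \<psi>) {v \<in> V. multiplicity p v = i} * sum (mu1 g \<theta>) {w \<in> W. multiplicity p w = j}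
          * exp (- C * K)) powr \<kappa>)"
proof -
  have p0: "0 < p" "1 < p" using prime_gt_0_nat[OF p] prime_gt_1_nat[OF p] by auto
  define V' where "V' = {v. \<not> p dvd v \<and> p ^ i * v \<in> V}"
  define W' where "W' = {w. \<not> p dvd w \<and> p ^ j * w \<in> W}"
  define E' where "E' = {(v, w). \<not> p dvd v \<and> \<not> p dvd w \<and> (p ^ i * v, p ^ j * w) \<in> E}"
  \<comment> \<open>With truncated subtraction at most one of \<open>j - i\<close> and
    \<open>i - j\<close> is nonzero, so at most one of the two weights receives an extra
    factor.\<close>
  define \<psi>' where "\<psi>' = (\<lambda>v. real p ^ (j - i) * \<psi> (p ^ i * v))"
  define \<theta>' where "\<theta>' = (\<lambda>w. real p ^ (i - j) * \<theta> (p ^ j * w))"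
  \<comment> \<open>If \<open>i\<close> and \<open>j\<close> differ, \<open>p\<close> may itself be
    one of the counted primes, and it is lost on passing to \<open>P - {p}\<close>.\<close>
  define K' where "K' = (if i = j then K else K - 1)"
  define F where "F = f (p ^ i) / (real p ^ i * real p ^ (j - i))"
  define G where "G = g (p ^ j) / (real p ^ j * real p ^ (i - j))"
  have EVW: "E \<subseteq> V \<times> W" and pos: "\<And>v. v \<in> V \<Longrightarrow> 0 < v \<and> 0 < \<psi> v" "\<And>w. w \<in> W \<Longrightarrow> 0 < w \<and> 0 < \<theta> w"
    using sys by (auto simp: gcd_system_def)
  have Vi: "{v \<in> V. multiplicity p v = i} = (*) (p ^ i) ` V'"
    unfolding V'_def using p pos by (intro class_eq_image) auto
  have Wj: "{w \<in> W. multiplicity p w = j} = (*) (p ^ j) ` W'"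
    unfolding W'_def using p pos by (intro class_eq_image) auto
  have Eij: "{(v, w) \<in> E. multiplicity p v = i \<and> multiplicity p w = j} = (\<lambda>(v, w). (p ^ i * v, p ^ j * w)) ` E'"
  proof (intro equalityI subsetI)
    fix e assume e: "e \<in> {(v, w) \<in> E. multiplicity p v = i \<and> multiplicity p w = j}"
    then have "fst e \<in> {v \<in> V. multiplicity p v = i}" "snd e \<in> {w \<in> W. multiplicity p w = j}"
      using EVW by auto
    then obtain v w where "v \<in> V'" "w \<in> W'" "e = (p ^ i * v, p ^ j * w)"
      unfolding Vi Wj by (cases e) auto
    moreover from this have "(v, w) \<in> E'" using e by (auto simp: E'_def V'_def W'_def)
    ultimately show "e \<in> (\<lambda>(v, w). (p ^ i * v, p ^ j * w)) ` E'" by force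
  next
    fix e assume "e \<in> (\<lambda>(v, w). (p ^ i * v, p ^ j * w)) ` E'"
    then show "e \<in> {(v, w) \<in> E. multiplicity p v = i \<and> multiplicity p w = j}"
      using p by (auto simp: E'_def multiplicity_prime_power_mult)
  qed
  have inj: "inj_on ((*) (p ^ k)) A" for k A using p0 by (auto simp: inj_on_def)
  have muV: "mu1 f \<psi> (p ^ i * v) = F * mu1 f \<psi>' v" if "\<not> p dvd v" for v
  proof -
    have "0 < v" "coprime (p ^ i) v" using that p by (auto intro: ccontr prime_imp_coprime)
    then have "f (p ^ i * v) = f (p ^ i) * f v" using f p0 by (intro admissible_mult) auto
    then show ?thesis using p0 by (simp add: mu1_def F_def \<psi>'_def)
  qed
  have muW: "mu1 g \<theta> (p ^ j * w) = G * mu1 g \<theta>' w" if "\<not> p dvd w" for w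
  proof -
    have "0 < w" "coprime (p ^ j) w" using that p by (auto intro: ccontr prime_imp_coprime)
    then have "g (p ^ j * w) = g (p ^ j) * g w" using g p0 by (intro admissible_mult) auto
    then show ?thesis using p0 by (simp add: mu1_def G_def \<theta>'_def)
  qed
  have sumV: "sum (mu1 f \<psi>) {v \<in> V. multiplicity p v = i} = F * sum (mu1 f \<psi>') V'"
    unfolding Vi sum.reindex[OF inj] o_def sum_distrib_left
    by (intro sum.cong refl muV) (auto simp: V'_def)
  have sumW: "sum (mu1 g \<theta>) {w \<in> W. multiplicity p w = j} = G * sum (mu1 g \<theta>') W'"
    unfolding Wj sum.reindex[OF inj] o_def sum_distrib_left
    by (intro sum.cong refl muW) (auto simp: W'_def)
  have injE: "inj_on (\<lambda>(v, w). (p ^ i * v, p ^ j * w)) E'" using p0 by (auto simp: inj_on_def)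
  have sumE: "(\<Sum>(v, w)\<in>{(v, w) \<in> E. multiplicity p v = i \<and> multiplicity p w = j}. mu1 f \<psi> v * mu1 g \<theta> w)
     = F * G * (\<Sum>(v, w)\<in>E'. mu1 f \<psi>' v * mu1 g \<theta>' w)"
    unfolding Eij sum.reindex[OF injE] o_def sum_distrib_left
    by (intro sum.cong refl) (auto simp: E'_def muV muW)
  have sys': "gcd_system (P - {p}) t K' \<psi>' \<theta>' V' W' E'"
    unfolding gcd_system_def
  proof (intro conjI ballI)
    show "finite (P - {p})" using sys by (auto simp: gcd_system_def)
    fix q assume "q \<in> P - {p}"
    then show "prime q" using sys by (auto simp: gcd_system_def)
  next
    have "finite ((*) (p ^ i) ` V')" "finite ((*) (p ^ j) ` W')"
      unfolding Vi[symmetric] Wj[symmetric] using sys by (auto simp: gcd_system_def)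
    then show "finite V'" "finite W'" using finite_imageD inj by blast+
    show "E' \<subseteq> V' \<times> W'" using EVW by (auto simp: E'_def V'_def W'_def)
  next
    fix v assume v: "v \<in> V'"
    then have v2: "\<not> p dvd v" "p ^ i * v \<in> V" by (auto simp: V'_def)
    from pos(1)[OF v2(2)] show "0 < v" "0 < \<psi>' v" using p0 by (auto simp: \<psi>'_def)
    have "prime_factors v \<subseteq> prime_factors (p ^ i * v)" using \<open>0 < v\<close> p0 by (intro dvd_prime_factors) auto
    also have "\<dots> \<subseteq> P" using sys v2 by (auto simp: gcd_system_def)
    finally show "prime_factors v \<subseteq> P - {p}" using v2 by (auto dest: in_prime_factors_imp_dvd)
  next
    fix w assume w: "w \<in> W'"
    then have w2: "\<not> p dvd w" "p ^ j * w \<in> W" by (auto simp: W'_def)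
    from pos(2)[OF w2(2)] show "0 < w" "0 < \<theta>' w" using p0 by (auto simp: \<theta>'_def)
    have "prime_factors w \<subseteq> prime_factors (p ^ j * w)" using \<open>0 < w\<close> p0 by (intro dvd_prime_factors) auto
    also have "\<dots> \<subseteq> P" using sys w2 by (auto simp: gcd_system_def)
    finally show "prime_factors w \<subseteq> P - {p}" using w2 by (auto dest: in_prime_factors_imp_dvd)
  next
    fix e assume "e \<in> E'"
    then obtain v w where e: "e = (v, w)" "\<not> p dvd v" "\<not> p dvd w" "(p ^ i * v, p ^ j * w) \<in> E"
      by (auto simp: E'_def)
    have gcd: "gcd (p ^ i * v) (p ^ j * w) = p ^ min i j * gcd v w"
      using e p by (intro gcd_prime_power_mult) auto
    have A: "real (p ^ j * w) * \<psi> (p ^ i * v) \<le> real (p ^ min i j * gcd v w)"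
      "real (p ^ i * v) * \<theta> (p ^ j * w) \<le> real (p ^ min i j * gcd v w)"
      "K \<le> real (card {q \<in> P. real q \<le> t \<and> multiplicity q (p ^ i * v) \<noteq> multiplicity q (p ^ j * w)})"
      using sys e(4) gcd by (auto simp: gcd_system_def)
    have "min i j + (j - i) = j" "min i j + (i - j) = i" by auto
    then have "real p ^ j = real p ^ min i j * real p ^ (j - i)" "real p ^ i = real p ^ min i j * real p ^ (i - j)"
      by (simp_all add: power_add[symmetric])
    then have "real p ^ min i j * (real w * \<psi>' v) \<le> real p ^ min i j * real (gcd v w)"
      "real p ^ min i j * (real v * \<theta>' w) \<le> real p ^ min i j * real (gcd v w)"
      using A(1,2) by (simp_all add: \<psi>'_def \<theta>'_def mult_ac)
    then have D: "real w * \<psi>' v \<le> real (gcd v w)" "real v * \<theta>' w \<le> real (gcd v w)"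
      using p0 by simp_all
    let ?S = "{q \<in> P - {p}. real q \<le> t \<and> multiplicity q v \<noteq> multiplicity q w}"
    have fin: "finite ?S" by (rule finite_subset[of _ "{..nat \<lfloor>t\<rfloor>}"]) (auto simp: le_nat_floor)
    have mq: "multiplicity q (p ^ i * v) = (if q = p then i else multiplicity q v)"
      "multiplicity q (p ^ j * w) = (if q = p then j else multiplicity q w)" if "prime q" for q
      using that e p multiplicity_prime_power_mult by auto
    have "{q \<in> P. real q \<le> t \<and> multiplicity q (p ^ i * v) \<noteq> multiplicity q (p ^ j * w)}
        \<subseteq> ?S \<union> (if i = j then {} else {p})"
    proof
      fix q assume q: "q \<in> {q \<in> P. real q \<le> t \<and> multiplicity q (p ^ i * v) \<noteq> multiplicity q (p ^ j * w)}"
      then have "prime q" using sys by (auto simp: gcd_system_def)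
      then show "q \<in> ?S \<union> (if i = j then {} else {p})" using q mq[of q] by (cases "q = p") auto
    qed
    then have "card {q \<in> P. real q \<le> t \<and> multiplicity q (p ^ i * v) \<noteq> multiplicity q (p ^ j * w)}
        \<le> card (?S \<union> (if i = j then {} else {p}))"
      using fin by (intro card_mono) auto
    also have "\<dots> \<le> card ?S + card (if i = j then {} else {p})" by (rule card_Un_le)
    finally have KK: "K' \<le> real (card ?S)" using A(3) by (auto simp: K'_def split: if_splits)
    show "case e of (v, w) \<Rightarrow> real w * \<psi>' v \<le> real (gcd v w) \<and> real v * \<theta>' w \<le> real (gcd v w)
        \<and> K' \<le> real (card {q \<in> P - {p}. real q \<le> t \<and> multiplicity q v \<noteq> multiplicity q w})"
      using D e KK by simp
  qed
  have nn: "0 \<le> F" "0 \<le> G" unfolding F_def G_def using admissible_nonneg[OF f, of "p ^ i"] admissible_nonneg[OF g, of "p ^ j"] p0 by simp_all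
  define X where "X = sum (mu1 f \<psi>') V' * sum (mu1 g \<theta>') W'"
  have X0: "0 \<le> X" unfolding X_def
    using sys' f g by (intro mult_nonneg_nonneg sum_nonneg mu1_nonneg) (auto simp: gcd_system_def)
  have FG: "F * G \<le> real p powr - real (i - j + (j - i))"
  proof -
    have "f (p ^ i) * g (p ^ j) \<le> real p ^ i * real p ^ j"
      using admissible_prime_power_le[OF f p] admissible_prime_power_le[OF g p] f g p0
      by (intro mult_mono) (auto intro: admissible_nonneg)
    then have "F * G \<le> (real p ^ i * real p ^ j) / ((real p ^ i * real p ^ (j - i)) * (real p ^ j * real p ^ (i - j)))"
      unfolding F_def G_def times_divide_times_eq by (rule divide_right_mono) simp
    also have "\<dots> = 1 / real p ^ (i - j + (j - i))" using p0 by (simp add: power_add)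
    also have "\<dots> = real p powr - real (i - j + (j - i))"
      using p0 by (simp add: powr_minus powr_realpow divide_inverse del: of_nat_add)
    finally show ?thesis .
  qed
  have "F * G * (\<Sum>(v, w)\<in>E'. mu1 f \<psi>' v * mu1 g \<theta>' w) \<le> F * G * (B * (X * exp (- C * K')) powr \<kappa>)"
    using bnd sys' nn unfolding edge_bound_def X_def by (intro mult_left_mono) auto
  also have "\<dots> = B * ((F * G) * X powr \<kappa> * exp (- C * K') powr \<kappa>)"
    using X0 by (simp add: powr_mult)
  \<comment> \<open>This separates the gain from \<open>F * G * X\<close>, the product of the
    measures of the two original classes.\<close>
  also have "(F * G) * X powr \<kappa> = (F * G) powr (1 - \<kappa>) * (F * G * X) powr \<kappa>"
  proof -
    have "(F * G) powr (1 - \<kappa>) * (F * G) powr \<kappa> = F * G"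
      using nn by (subst powr_add[symmetric]) (simp add: powr_one)
    moreover have "(F * G * X) powr \<kappa> = (F * G) powr \<kappa> * X powr \<kappa>" by (rule powr_mult)
    ultimately show ?thesis by (metis mult.assoc)
  qed
  also have "exp (- C * K') powr \<kappa> = (if i = j then 1 else exp (C * \<kappa>)) * exp (- C * K) powr \<kappa>"
    by (auto simp: K'_def powr_def exp_add[symmetric] algebra_simps)
  also have "B * ((F * G) powr (1 - \<kappa>) * (F * G * X) powr \<kappa> * ((if i = j then 1 else exp (C * \<kappa>)) * exp (- C * K) powr \<kappa>))
     = B * ((F * G) powr (1 - \<kappa>) * (if i = j then 1 else exp (C * \<kappa>)) * (F * G * X * exp (- C * K)) powr \<kappa>)"
    using nn X0 by (simp add: powr_mult)
  also have "(F * G) powr (1 - \<kappa>) \<le> (real p powr - real (i - j + (j - i))) powr (1 - \<kappa>)"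
    using FG nn \<kappa> by (intro powr_mono2) auto
  also have "\<dots> = (real p powr - (1 - \<kappa>)) powr real (i - j + (j - i))"
    by (simp add: powr_powr algebra_simps)
  also have "\<dots> = (real p powr - (1 - \<kappa>)) ^ (i - j + (j - i))"
    using p0 by (simp add: powr_realpow del: of_nat_add)
  also have "\<dots> * (if i = j then 1 else exp (C * \<kappa>)) = class_weight (exp (C * \<kappa>)) (real p powr - (1 - \<kappa>)) i j"
    by (simp add: class_weight_def)
  finally show ?thesis unfolding sumE sumV sumW X_def using B by (simp add: mult_left_mono mult_right_mono mult_ac)
qed

lemma sum_over_classes:
  fixes h :: "nat \<times> nat \<Rightarrow> real"
  assumes "finite E" "finite J"
  shows "sum h {(v, w) \<in> E. c v \<in> J \<and> c w \<in> J}
    = (\<Sum>i\<in>J. \<Sum>j\<in>J. sum h {(v, w) \<in> E. c v = i \<and> c w = j})"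
proof -
  have "sum h {(v, w) \<in> E. c v \<in> J \<and> c w \<in> J}
      = (\<Sum>y\<in>J \<times> J. sum h {e \<in> {(v, w) \<in> E. c v \<in> J \<and> c w \<in> J}. (\<lambda>(v, w). (c v, c w)) e = y})"
    using assms by (intro sum.group[symmetric]) (auto intro: finite_subset[OF _ assms(1)])
  also have "\<dots> = (\<Sum>y\<in>J \<times> J. sum h {(v, w) \<in> E. c v = fst y \<and> c w = snd y})"
    by (intro sum.cong refl arg_cong[of _ _ "sum h"]) auto
  finally show ?thesis by (simp add: sum.cartesian_product' case_prod_beta)
qed

lemma edge_bound_restrict:
  assumes bnd: "edge_bound f g t C \<kappa> (P - {p}) B" and sys: "gcd_system P t K \<psi> \<theta> V W E"
    and p: "prime p" and f: "admissible f" and g: "admissible g"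
    and \<kappa>: "0 < \<kappa>" "\<kappa> < 1" and C: "0 < C" and B: "0 \<le> B" and J: "finite J"
  shows "(\<Sum>(v, w)\<in>{(v, w) \<in> E. multiplicity p v \<in> J \<and> multiplicity p w \<in> J}. mu1 f \<psi> v * mu1 g \<theta> w)
    \<le> B * exp (- C * K) powr \<kappa> *
      (\<Sum>i\<in>J. \<Sum>j\<in>J. class_weight (exp (C * \<kappa>)) (real p powr - (1 - \<kappa>)) i j *
        (sum (mu1 f \<psi>) {v \<in> V. multiplicity p v = i} * sum (mu1 g \<theta>) {w \<in> W. multiplicity p w = j}) powr \<kappa>)"
proof -
  define \<alpha> where "\<alpha> i = sum (mu1 f \<psi>) {v \<in> V. multiplicity p v = i}" for i
  define \<beta> where "\<beta> j = sum (mu1 g \<theta>) {w \<in> W. multiplicity p w = j}" for j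
  have "finite E" using sys by (auto simp: gcd_system_def intro: finite_subset)
  then have "(\<Sum>(v, w)\<in>{(v, w) \<in> E. multiplicity p v \<in> J \<and> multiplicity p w \<in> J}. mu1 f \<psi> v * mu1 g \<theta> w)
    = (\<Sum>i\<in>J. \<Sum>j\<in>J. \<Sum>(v, w)\<in>{(v, w) \<in> E. multiplicity p v = i \<and> multiplicity p w = j}. mu1 f \<psi> v * mu1 g \<theta> w)"
    using J by (rule sum_over_classes)
  also have "\<dots> \<le> (\<Sum>i\<in>J. \<Sum>j\<in>J. B * (class_weight (exp (C * \<kappa>)) (real p powr - (1 - \<kappa>)) i j *
        (\<alpha> i * \<beta> j * exp (- C * K)) powr \<kappa>))"
    unfolding \<alpha>_def \<beta>_def by (intro sum_mono edge_class_bound[OF bnd sys p f g \<kappa> C B])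
  finally show ?thesis unfolding \<alpha>_def[symmetric] \<beta>_def[symmetric] by (simp add: powr_mult sum_distrib_left mult_ac)
qed

text \<open>The bound \<kappa> \<open><= 9/10\<close>, that is \<epsilon> \<open><= 2/5\<close>,
  keeps \<open>q\<close> away from \<open>1\<close> uniformly in \<open>p\<close>: its tenth power
  is at most \<open>1 / p <= 1/2\<close>, so \<open>q <= 94/100\<close> and
  \<open>2 * q / (1 - q) <= 32\<close>. The constant \<open>100\<close> leaves room to
  spare.\<close>

lemma small_prime_weight_le:
  assumes "prime (p::nat)" "1/2 \<le> \<kappa>" "\<kappa> \<le> 9/10" "0 < C"
  shows "1 + exp (C * \<kappa>) * (2 * real p powr - (1 - \<kappa>) / (1 - real p powr - (1 - \<kappa>))) \<le> 100 * exp C"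
proof -
  define q where "q = real p powr - (1 - \<kappa>)"
  have p2: "2 \<le> real p" using prime_ge_2_nat[OF assms(1)] by simp
  have q0: "0 < q" using p2 by (simp add: q_def)
  have "(q ^ 10) = real p powr (- (1 - \<kappa>) * 10)" using p2 by (simp add: q_def powr_powr flip: powr_realpow)
  also have "\<dots> \<le> real p powr - 1" using p2 assms by (intro powr_mono) auto
  also have "\<dots> \<le> 1 / 2" using p2 by (simp add: powr_minus_divide)
  also have "\<dots> \<le> (94/100) ^ 10" by (simp add: power_divide)
  finally have q1: "q \<le> 94/100" by (rule power_le_imp_le_base[of _ 9, simplified]) simp
  have "2 * q / (1 - q) \<le> 2 * (94/100) / (1 - 94/100)" using q0 q1 by (intro frac_le) auto
  then have G: "2 * q / (1 - q) \<le> 32" by simp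
  have e: "exp (C * \<kappa>) \<le> exp C" using assms by simp
  have "1 + exp (C * \<kappa>) * (2 * q / (1 - q)) \<le> 1 + exp C * 32"
    using q0 q1 G e by (intro add_mono mult_mono) auto
  also have "\<dots> \<le> 100 * exp C" using assms one_le_exp_iff[of C] by linarith
  finally show ?thesis by (simp add: q_def)
qed

lemma sum_classes:
  fixes h :: "nat \<Rightarrow> real"
  assumes "finite V" "finite I" "c ` V \<subseteq> I"
  shows "(\<Sum>i\<in>I. sum h {v \<in> V. c v = i}) = sum h V"
  using assms by (rule sum.group)

lemma edge_bound_small_prime:
  assumes bnd: "edge_bound f g t C \<kappa> (P - {p}) B"
    and p: "prime p" and f: "admissible f" and g: "admissible g"
    and \<kappa>: "1/2 \<le> \<kappa>" "\<kappa> \<le> 9/10" and C: "0 < C" and B: "0 \<le> B"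
  shows "edge_bound f g t C \<kappa> P (100 * exp C * B)"
  unfolding edge_bound_def
proof (intro allI impI)
  fix \<psi> \<theta> V W E K
  assume sys: "gcd_system P t K \<psi> \<theta> V W E"
  define I where "I = multiplicity p ` V \<union> multiplicity p ` W"
  define \<alpha> where "\<alpha> i = sum (mu1 f \<psi>) {v \<in> V. multiplicity p v = i}" for i
  define \<beta> where "\<beta> j = sum (mu1 g \<theta>) {w \<in> W. multiplicity p w = j}" for j
  define q where "q = real p powr - (1 - \<kappa>)"
  have fin: "finite V" "finite W" "E \<subseteq> V \<times> W" using sys by (auto simp: gcd_system_def)
  then have finI: "finite I" by (simp add: I_def)
  have nn: "0 \<le> \<alpha> i" "0 \<le> \<beta> i" for i unfolding \<alpha>_def \<beta>_def
    using sys f g by (auto intro!: sum_nonneg mu1_nonneg simp: gcd_system_def)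
  have q: "0 < q" "q < 1" using prime_gt_1_nat[OF p] \<kappa>
    by (auto simp: q_def powr_less_one)
  have "E = {(v, w) \<in> E. multiplicity p v \<in> I \<and> multiplicity p w \<in> I}"
    using fin by (auto simp: I_def)
  then have "(\<Sum>(v, w)\<in>E. mu1 f \<psi> v * mu1 g \<theta> w) \<le> B * exp (- C * K) powr \<kappa> *
      (\<Sum>i\<in>I. \<Sum>j\<in>I. class_weight (exp (C * \<kappa>)) q i j * (\<alpha> i * \<beta> j) powr \<kappa>)"
    using edge_bound_restrict[OF bnd sys p f g _ _ C B finI] \<kappa> unfolding \<alpha>_def \<beta>_def q_def by simp
  also have "\<dots> \<le> B * exp (- C * K) powr \<kappa> * ((1 + exp (C * \<kappa>) * (2 * q / (1 - q))) * (sum \<alpha> I * sum \<beta> I) powr \<kappa>)"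
    using B finI nn \<kappa> q by (intro mult_left_mono sum_class_weight_le') auto
  also have "\<dots> \<le> B * exp (- C * K) powr \<kappa> * (100 * exp C * (sum \<alpha> I * sum \<beta> I) powr \<kappa>)"
    using B small_prime_weight_le[OF p \<kappa> C] unfolding q_def by (intro mult_left_mono mult_right_mono) auto
  also have "sum \<alpha> I = sum (mu1 f \<psi>) V"
    unfolding \<alpha>_def using fin finI by (intro sum_classes) (auto simp: I_def)
  also have "sum \<beta> I = sum (mu1 g \<theta>) W"
    unfolding \<beta>_def using fin finI by (intro sum_classes) (auto simp: I_def)
  finally show "(\<Sum>(v, w)\<in>E. mu1 f \<psi> v * mu1 g \<theta> w) \<le> 100 * exp C * B *
      (sum (mu1 f \<psi>) V * sum (mu1 g \<theta>) W * exp (- C * K)) powr \<kappa>"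
    by (simp add: powr_mult mult_ac)
qed

text \<open>Divided by the total measures, the class measures become probability vectors, to which
  the dichotomy applies. The exponent \<open>k\<close> depends on the system, so the statement
  concerns a single system.\<close>

lemma edge_bound_large_prime:
  assumes bnd: "edge_bound f g t C \<kappa> (P - {p}) B" and sys: "gcd_system P t K \<psi> \<theta> V W E"
    and p: "prime p" and f: "admissible f" and g: "admissible g"
    and e: "0 < \<epsilon>" "\<epsilon> < 1/2" and \<kappa>: "\<kappa> = 1/2 + \<epsilon>" and C: "0 < C" and B: "0 \<le> B"
    and L: "L = exp (C * \<kappa>)" and q: "q = real p powr - (1 - \<kappa>)"
    and q_small: "4 * L * q \<le> 1" "(4 * L * q / \<epsilon>) powr (2 * \<epsilon>) \<le> 1/4"
  defines "Z \<equiv> (sum (mu1 f \<psi>) V * sum (mu1 g \<theta>) W * exp (- C * K)) powr \<kappa>"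
  shows "(\<Sum>(v, w)\<in>E. mu1 f \<psi> v * mu1 g \<theta> w) \<le> B * Z
    \<or> (\<exists>k. (\<Sum>(v, w)\<in>{(v, w) \<in> E. multiplicity p v \<noteq> k \<and> multiplicity p w \<noteq> k}. mu1 f \<psi> v * mu1 g \<theta> w)
        \<le> 2 * (48 * L) powr (2 * \<kappa> / (1 - \<kappa>)) * real p powr (- 2 * \<kappa>) * (B * Z))"
proof -
  define I where "I = multiplicity p ` V \<union> multiplicity p ` W"
  define \<alpha> where "\<alpha> i = sum (mu1 f \<psi>) {v \<in> V. multiplicity p v = i}" for i
  define \<beta> where "\<beta> j = sum (mu1 g \<theta>) {w \<in> W. multiplicity p w = j}" for j
  define MV where "MV = sum (mu1 f \<psi>) V"
  define MW where "MW = sum (mu1 g \<theta>) W"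
  have fin: "finite V" "finite W" "E \<subseteq> V \<times> W" using sys by (auto simp: gcd_system_def)
  then have finI: "finite I" by (simp add: I_def)
  have mu_nn: "\<And>v. v \<in> V \<Longrightarrow> 0 \<le> mu1 f \<psi> v" "\<And>w. w \<in> W \<Longrightarrow> 0 \<le> mu1 g \<theta> w"
    using sys f g by (auto intro!: mu1_nonneg simp: gcd_system_def)
  have nn: "0 \<le> \<alpha> i" "0 \<le> \<beta> i" for i unfolding \<alpha>_def \<beta>_def
    using mu_nn by (auto intro!: sum_nonneg)
  have M0: "0 \<le> MV" "0 \<le> MW" unfolding MV_def MW_def using mu_nn by (auto intro!: sum_nonneg)
  have q0: "0 < q" using prime_gt_0_nat[OF p] by (simp add: q)
  have \<kappa>1: "0 < \<kappa>" "\<kappa> < 1" using e \<kappa> by auto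
  show ?thesis
  proof (cases "MV = 0 \<or> MW = 0")
    case True
    have "mu1 f \<psi> v * mu1 g \<theta> w = 0" if "(v, w) \<in> E" for v w
      using True that fin mu_nn by (auto simp: MV_def MW_def sum_nonneg_eq_0_iff)
    then have "(\<Sum>(v, w)\<in>E. mu1 f \<psi> v * mu1 g \<theta> w) = 0" by (intro sum.neutral) auto
    then show ?thesis using B by (simp add: Z_def)
  next
    case False
    then have M: "0 < MV" "0 < MW" using M0 by auto
    define \<alpha>' where "\<alpha>' = (\<lambda>i. \<alpha> i / MV)"
    define \<beta>' where "\<beta>' = (\<lambda>i. \<beta> i / MW)"
    have one: "sum \<alpha>' I = 1" "sum \<beta>' I = 1"
      using M sum_classes[OF fin(1) finI, of "multiplicity p" "mu1 f \<psi>"]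
        sum_classes[OF fin(2) finI, of "multiplicity p" "mu1 g \<theta>"]
      unfolding \<alpha>'_def \<beta>'_def \<alpha>_def \<beta>_def sum_divide_distrib[symmetric] MV_def MW_def
      by (auto simp: I_def)
    have L1: "1 \<le> L" using C \<kappa>1 by (simp add: L)
    have restr: "(\<Sum>(v, w)\<in>{(v, w) \<in> E. multiplicity p v \<in> J \<and> multiplicity p w \<in> J}. mu1 f \<psi> v * mu1 g \<theta> w)
       \<le> (\<Sum>i\<in>J. \<Sum>j\<in>J. class_weight L q i j * (\<alpha>' i * \<beta>' j) powr \<kappa>) * (B * Z)" if "finite J" for J
    proof -
      have ab: "(\<alpha> i * \<beta> j) powr \<kappa> = (\<alpha>' i * \<beta>' j) powr \<kappa> * (MV * MW) powr \<kappa>" for i j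
        using M by (subst powr_mult[symmetric]) (simp add: \<alpha>'_def \<beta>'_def)
      show ?thesis using edge_bound_restrict[OF bnd sys p f g \<kappa>1 C B that]
        unfolding \<alpha>_def[symmetric] \<beta>_def[symmetric] L[symmetric] q[symmetric] ab Z_def
          MV_def[symmetric] MW_def[symmetric]
        by (simp add: powr_mult sum_distrib_left sum_distrib_right mult_ac)
    qed
    have BZ: "0 \<le> B * Z" using B by (simp add: Z_def)
    from sum_class_weight_dichotomy[OF finI _ _ one e \<kappa> L1 q0 q_small]
    consider "(\<Sum>i\<in>I. \<Sum>j\<in>I. class_weight L q i j * (\<alpha>' i * \<beta>' j) powr \<kappa>) \<le> 1"
      | k where "(\<Sum>i\<in>I - {k}. \<Sum>j\<in>I - {k}. class_weight L q i j * (\<alpha>' i * \<beta>' j) powr \<kappa>)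
            \<le> 2 * (48 * L * q) powr (2 * \<kappa> / (1 - \<kappa>))"
      using nn M by (auto simp: \<alpha>'_def \<beta>'_def)
    then show ?thesis
    proof cases
      case 1
      have "E = {(v, w) \<in> E. multiplicity p v \<in> I \<and> multiplicity p w \<in> I}"
        using fin by (auto simp: I_def)
      then have "(\<Sum>(v, w)\<in>E. mu1 f \<psi> v * mu1 g \<theta> w) \<le> B * Z"
        using restr[OF finI] mult_right_mono[OF 1 BZ] by simp
      then show ?thesis ..
    next
      case 2
      have E: "{(v, w) \<in> E. multiplicity p v \<noteq> k \<and> multiplicity p w \<noteq> k}
          = {(v, w) \<in> E. multiplicity p v \<in> I - {k} \<and> multiplicity p w \<in> I - {k}}"
        using fin by (auto simp: I_def)
      have "q powr (2 * \<kappa> / (1 - \<kappa>)) = real p powr (- 2 * \<kappa>)"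
      proof -
        have "(1 - \<kappa>) * (2 * \<kappa> / (1 - \<kappa>)) = 2 * \<kappa>" using \<kappa>1 by simp
        then show ?thesis unfolding q powr_powr by (simp only: mult_minus_left)
      qed
      then have q2: "(48 * L * q) powr (2 * \<kappa> / (1 - \<kappa>)) = (48 * L) powr (2 * \<kappa> / (1 - \<kappa>)) * real p powr (- 2 * \<kappa>)"
        by (simp only: powr_mult)
      have "(\<Sum>(v, w)\<in>{(v, w) \<in> E. multiplicity p v \<noteq> k \<and> multiplicity p w \<noteq> k}. mu1 f \<psi> v * mu1 g \<theta> w)
        \<le> 2 * (48 * L * q) powr (2 * \<kappa> / (1 - \<kappa>)) * (B * Z)"
        unfolding E using restr[of "I - {k}"] finI mult_right_mono[OF 2 BZ] by simp
      then show ?thesis unfolding q2 by (auto simp: mult.assoc)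
    qed
  qed
qed

section \<open>Systems in which every edge touches a prescribed exponent at each prime\<close>

section \<open>Concentrated systems\<close>

text \<open>With truncated subtraction, these are \<open>v\<^sub>+\<close> and \<open>v\<^sub>-\<close> in \<open>v = N v\<^sub>+ / v\<^sub>-\<close>.\<close>

definition over_part :: "nat set \<Rightarrow> (nat \<Rightarrow> nat) \<Rightarrow> nat \<Rightarrow> nat" where
  "over_part P k v = (\<Prod>p\<in>P. p ^ (multiplicity p v - k p))"

definition under_part :: "nat set \<Rightarrow> (nat \<Rightarrow> nat) \<Rightarrow> nat \<Rightarrow> nat" where
  "under_part P k v = (\<Prod>p\<in>P. p ^ (k p - multiplicity p v))"

text \<open>The number of primes counted by \<open>K\<close> for an edge is at most the sum of the
  deviations of its ends, so that condition splits into a function of \<open>v\<close> and a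
  function of \<open>w\<close>.\<close>

definition deviations :: "nat set \<Rightarrow> real \<Rightarrow> (nat \<Rightarrow> nat) \<Rightarrow> nat \<Rightarrow> nat" where
  "deviations P t k v = card {p \<in> P. real p \<le> t \<and> multiplicity p v \<noteq> k p}"

lemma prod_prime_powers_eq:
  fixes v :: nat
  assumes "finite P" "\<And>p. p \<in> P \<Longrightarrow> prime p" "0 < v" "prime_factors v \<subseteq> P"
  shows "(\<Prod>p\<in>P. p ^ multiplicity p v) = v"
proof -
  have "(\<Prod>p\<in>P. p ^ multiplicity p v) = (\<Prod>p\<in>prime_factors v. p ^ multiplicity p v)"
    using assms by (intro prod.mono_neutral_right) (auto simp: prime_factors_multiplicity)
  then show ?thesis using assms prime_factorization_nat[of v] by simp
qed

lemma admissible_prod_prime_powers: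
  assumes "admissible f" "finite P" "\<And>p. p \<in> P \<Longrightarrow> prime p"
  shows "f (\<Prod>p\<in>P. p ^ e p) = (\<Prod>p\<in>P. f (p ^ e p))"
  using assms(2,3)
proof (induction P rule: finite_induct)
  case empty
  then show ?case using admissible_one[OF assms(1)] by simp
next
  case (insert p P)
  have "coprime (p ^ e p) (\<Prod>p\<in>P. p ^ e p)"
  proof (rule prod_coprime_right)
    fix q assume "q \<in> P"
    then have "coprime p q" using insert by (intro primes_coprime) auto
    then show "coprime (p ^ e p) (q ^ e q)" by simp
  qed
  moreover have "0 < (\<Prod>p\<in>P. p ^ e p)" using insert by (intro prod_pos) (auto simp: prime_gt_0_nat)
  ultimately have "f (p ^ e p * (\<Prod>p\<in>P. p ^ e p)) = f (p ^ e p) * f (\<Prod>p\<in>P. p ^ e p)"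
    using insert by (intro admissible_mult[OF assms(1)]) (auto simp: prime_gt_0_nat)
  then show ?case using insert by simp
qed

text \<open>For \<open>i <= n\<close> the denominator is just \<open>p ^ n\<close>. For
  \<open>n > 0\<close> the numerators add up to the sum of \<open>f (p ^ i)\<close> over
  \<open>i <= n\<close> plus \<open>z - 1\<close> times the sum over \<open>i < n\<close>; the
  convolution hypothesis bounds these sums by \<open>p ^ n\<close> and
  \<open>p ^ (n - 1)\<close>.\<close>

lemma sum_prime_weight_le:
  assumes f: "admissible f" and p: "prime p" and z: "1 \<le> z"
  shows "(\<Sum>i\<le>n. f (p ^ i) / (real p ^ n * real p ^ (i - n)) * (if i \<noteq> n then z else 1))
    \<le> 1 + (z - 1) / real p"
proof (cases n)
  case 0
  then show ?thesis using admissible_one[OF f] z by simp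
next
  case (Suc m)
  have p0: "0 < real p" using prime_gt_0_nat[OF p] by simp
  have "(\<Sum>i\<le>n. f (p ^ i) / (real p ^ n * real p ^ (i - n)) * (if i \<noteq> n then z else 1))
      = f (p ^ n) / real p ^ n + (\<Sum>i\<le>m. f (p ^ i) / real p ^ n * z)"
    unfolding Suc by (simp add: atMost_Suc)
  also have "\<dots> = ((\<Sum>i\<le>n. f (p ^ i)) + (z - 1) * (\<Sum>i\<le>m. f (p ^ i))) / real p ^ n"
    unfolding Suc by (simp add: sum_distrib_left sum_distrib_right sum_divide_distrib add_divide_distrib
        diff_divide_distrib algebra_simps sum_subtractf)
  also have "\<dots> \<le> (real p ^ n + (z - 1) * real p ^ m) / real p ^ n"
    using admissible_sum_prime_powers_le[OF f p] z by (intro divide_right_mono add_mono mult_left_mono) auto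
  also have "\<dots> = 1 + (z - 1) / real p" using p0 by (simp add: Suc field_simps)
  finally show ?thesis .
qed

locale centred =
  fixes P :: "nat set" and k :: "nat \<Rightarrow> nat" and t :: real
  assumes finite_P: "finite P" and prime_P: "p \<in> P \<Longrightarrow> prime p"
begin

abbreviation smooth :: "nat \<Rightarrow> bool" where "smooth v \<equiv> 0 < v \<and> prime_factors v \<subseteq> P"

abbreviation centre :: nat where "centre \<equiv> \<Prod>p\<in>P. p ^ k p"

lemma prime_P_pos: "p \<in> P \<Longrightarrow> 0 < p"
  using prime_P prime_gt_0_nat by blast

lemma over_part_pos: "0 < over_part P k v"
  unfolding over_part_def using prime_P_pos by (intro prod_pos) auto

lemma under_part_pos: "0 < under_part P k v"
  unfolding under_part_def using prime_P_pos by (intro prod_pos) auto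

lemma multiplicity_over_part: "p \<in> P \<Longrightarrow> multiplicity p (over_part P k v) = multiplicity p v - k p"
  unfolding over_part_def using finite_P prime_P by (subst multiplicity_prod_prime_powers) auto

lemma mult_under_part:
  assumes "smooth v"
  shows "v * under_part P k v = centre * over_part P k v"
proof -
  have "v * under_part P k v = (\<Prod>p\<in>P. p ^ multiplicity p v) * under_part P k v"
    using prod_prime_powers_eq[OF finite_P prime_P] assms by simp
  also have "\<dots> = centre * over_part P k v"
    unfolding under_part_def over_part_def prod.distrib[symmetric] power_add[symmetric]
    by (intro prod.cong refl arg_cong2[of _ _ _ _ "(^)"]) auto
  finally show ?thesis .
qed

text \<open>If one of the multiplicities \<open>a\<close>, \<open>b\<close> of \<open>v\<close>,
  \<open>w\<close> equals \<open>k p\<close>, then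
  \<open>min a b + (k p - a) + (b - k p) = b\<close>. Hence \<open>w / gcd v w\<close> is a product
  of a factor depending on \<open>v\<close> and one depending on \<open>w\<close>, which decouples
  \<open>D <= 1\<close>.\<close>

lemma gcd_mult_parts:
  assumes "smooth v" "smooth w" "\<And>p. p \<in> P \<Longrightarrow> multiplicity p v = k p \<or> multiplicity p w = k p"
  shows "gcd v w * (under_part P k v * over_part P k w) = w"
proof -
  have "prime_factors (gcd v w) \<subseteq> prime_factors v" using assms by (intro dvd_prime_factors) auto
  then have "smooth (gcd v w)" using assms by auto
  then have "gcd v w * (under_part P k v * over_part P k w)
      = (\<Prod>p\<in>P. p ^ multiplicity p (gcd v w)) * (under_part P k v * over_part P k w)"
    using prod_prime_powers_eq[OF finite_P prime_P] by simp
  also have "\<dots> = (\<Prod>p\<in>P. p ^ multiplicity p w)"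
    unfolding under_part_def over_part_def prod.distrib[symmetric] power_add[symmetric]
  proof (intro prod.cong refl arg_cong2[of _ _ _ _ "(^)"])
    fix p assume p: "p \<in> P"
    have "multiplicity p (gcd v w) = min (multiplicity p v) (multiplicity p w)"
      using assms prime_P[OF p] by (intro multiplicity_gcd) auto
    then show "multiplicity p (gcd v w) + (k p - multiplicity p v + (multiplicity p w - k p)) = multiplicity p w"
      using assms(3)[OF p] by auto
  qed
  also have "\<dots> = w" using prod_prime_powers_eq[OF finite_P prime_P] assms by simp
  finally show ?thesis .
qed

text \<open>An Euler product. Fixing \<open>v\<^sub>+ = a\<close> determines the exponent at each
  prime dividing \<open>a\<close>, where the local factor is at most \<open>z p\<close>; at the
  other primes the exponents are at most \<open>k p\<close> and may be summed independently.\<close>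

lemma sum_fixed_over_part_le:
  assumes f: "admissible f" and z: "\<And>p. p \<in> P \<Longrightarrow> 1 \<le> z p"
    and U: "finite U" "\<And>v. v \<in> U \<Longrightarrow> smooth v \<and> over_part P k v = a"
  shows "(\<Sum>v\<in>U. f v / (real centre * real (over_part P k v)) * (\<Prod>p\<in>P. if multiplicity p v \<noteq> k p then z p else 1))
    \<le> (\<Prod>p\<in>P. if p dvd a then z p else 1) * (\<Prod>p\<in>P. 1 + (z p - 1) / real p)"
proof -
  define h where "h p i = f (p ^ i) / (real p ^ k p * real p ^ (i - k p)) * (if i \<noteq> k p then z p else 1)" for p i
  define Q where "Q = {p \<in> P. \<not> p dvd a}"
  have finQ: "finite Q" "Q \<subseteq> P" using finite_P by (auto simp: Q_def)
  have h0: "0 \<le> h p i" if "p \<in> P" for p i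
    unfolding h_def using z[OF that] prime_P_pos[OF that] admissible_nonneg[OF f, of "p ^ i"] by auto
  have hz: "h p i \<le> z p" if "p \<in> P" "k p < i" for p i
  proof -
    have "real p ^ k p * real p ^ (i - k p) = real p ^ i" using that by (simp add: power_add[symmetric])
    moreover have "f (p ^ i) / real p ^ i \<le> 1"
      using admissible_prime_power_le[OF f prime_P[OF that(1)], of i] prime_P_pos[OF that(1)] by simp
    ultimately show ?thesis unfolding h_def using z[OF that(1)] that(2)
        mult_right_mono[of "f (p ^ i) / real p ^ i" 1 "z p"] by simp
  qed
  have sm: "smooth v" "multiplicity p a = multiplicity p v - k p" if "v \<in> U" "p \<in> P" for v p
    using U(2)[OF that(1)] multiplicity_over_part[OF that(2)] by auto
  have a0: "0 < a" if "v \<in> U" for v using over_part_pos U(2)[OF that] by auto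
  have dvd: "p dvd a \<longleftrightarrow> k p < multiplicity p v" if "v \<in> U" "p \<in> P" for v p
  proof -
    have "p dvd a \<longleftrightarrow> 0 < multiplicity p a"
      using a0[OF that(1)] prime_P[OF that(2)] by (auto simp: prime_multiplicity_gt_zero_iff)
    then show ?thesis using sm(2)[OF that] by auto
  qed
  have "(\<Sum>v\<in>U. f v / (real centre * real (over_part P k v)) * (\<Prod>p\<in>P. if multiplicity p v \<noteq> k p then z p else 1))
      = (\<Sum>v\<in>U. \<Prod>p\<in>P. h p (multiplicity p v))"
  proof (intro sum.cong refl)
    fix v assume v: "v \<in> U"
    have "f v = f (\<Prod>p\<in>P. p ^ multiplicity p v)"
      using prod_prime_powers_eq[OF finite_P prime_P] U(2)[OF v] by simp
    also have "\<dots> = (\<Prod>p\<in>P. f (p ^ multiplicity p v))"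
      using f finite_P prime_P by (rule admissible_prod_prime_powers)
    finally show "f v / (real centre * real (over_part P k v)) * (\<Prod>p\<in>P. if multiplicity p v \<noteq> k p then z p else 1)
        = (\<Prod>p\<in>P. h p (multiplicity p v))"
      unfolding h_def over_part_def prod.distrib prod_dividef by simp
  qed
  also have "\<dots> \<le> (\<Sum>v\<in>U. (\<Prod>p\<in>P. if p dvd a then z p else 1) * (\<Prod>p\<in>Q. h p (multiplicity p v)))"
  proof (intro sum_mono)
    fix v assume v: "v \<in> U"
    have "(\<Prod>p\<in>P. h p (multiplicity p v))
        \<le> (\<Prod>p\<in>P. (if p dvd a then z p else 1) * (if p dvd a then 1 else h p (multiplicity p v)))"
      using h0 hz dvd[OF v] by (intro prod_mono) auto
    also have "\<dots> = (\<Prod>p\<in>P. if p dvd a then z p else 1) * (\<Prod>p\<in>P. if p dvd a then 1 else h p (multiplicity p v))"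
      by (rule prod.distrib)
    also have "(\<Prod>p\<in>P. if p dvd a then 1 else h p (multiplicity p v)) = (\<Prod>p\<in>Q. h p (multiplicity p v))"
      using finite_P by (intro prod.mono_neutral_cong_right) (auto simp: Q_def)
    finally show "(\<Prod>p\<in>P. h p (multiplicity p v))
        \<le> (\<Prod>p\<in>P. if p dvd a then z p else 1) * (\<Prod>p\<in>Q. h p (multiplicity p v))" .
  qed
  also have "\<dots> = (\<Prod>p\<in>P. if p dvd a then z p else 1) * (\<Sum>v\<in>U. \<Prod>p\<in>Q. h p (multiplicity p v))"
    by (simp add: sum_distrib_left)
  also have "(\<Sum>v\<in>U. \<Prod>p\<in>Q. h p (multiplicity p v)) \<le> (\<Prod>p\<in>P. 1 + (z p - 1) / real p)"
  proof -
    \<comment> \<open>A vertex is encoded by its exponents at the primes of \<open>Q\<close>; the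
      remaining ones are forced by \<open>a\<close>, so the encoding is injective.\<close>
    define m where "m v = restrict (\<lambda>p. multiplicity p v) Q" for v :: nat
    have inj: "inj_on m U"
    proof (rule inj_onI)
      fix v w assume vw: "v \<in> U" "w \<in> U" "m v = m w"
      have "multiplicity p v = multiplicity p w" if p: "p \<in> P" for p
      proof (cases "p dvd a")
        case True
        then show ?thesis using dvd[OF vw(1) p] dvd[OF vw(2) p] sm(2)[OF vw(1) p] sm(2)[OF vw(2) p] by auto
      next
        case False
        then show ?thesis using fun_cong[OF vw(3), of p] p by (simp add: m_def Q_def)
      qed
      then have "(\<Prod>p\<in>P. p ^ multiplicity p v) = (\<Prod>p\<in>P. p ^ multiplicity p w)"
        by (intro prod.cong) auto
      then show "v = w" using prod_prime_powers_eq[OF finite_P prime_P] U(2)[OF vw(1)] U(2)[OF vw(2)] by simp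
    qed
    have "(\<Sum>v\<in>U. \<Prod>p\<in>Q. h p (multiplicity p v)) = (\<Sum>\<phi>\<in>m ` U. \<Prod>p\<in>Q. h p (\<phi> p))"
      unfolding sum.reindex[OF inj] o_def by (intro sum.cong prod.cong refl) (auto simp: m_def)
    also have "\<dots> \<le> (\<Sum>\<phi>\<in>PiE Q (\<lambda>p. {..k p}). \<Prod>p\<in>Q. h p (\<phi> p))"
    proof (rule sum_mono2)
      show "finite (PiE Q (\<lambda>p. {..k p}))" using finQ by (intro finite_PiE) auto
      have "multiplicity p v \<le> k p" if "v \<in> U" "p \<in> Q" for v p
        using dvd[OF that(1), of p] that(2) by (auto simp: Q_def)
      then show "m ` U \<subseteq> PiE Q (\<lambda>p. {..k p})" by (auto simp: m_def)
    qed (use h0 finQ in \<open>auto intro!: prod_nonneg\<close>)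
    also have "\<dots> = (\<Prod>p\<in>Q. \<Sum>i\<le>k p. h p i)" using finQ by (intro prod_sum_PiE[symmetric]) auto
    also have "\<dots> \<le> (\<Prod>p\<in>Q. 1 + (z p - 1) / real p)"
    proof (intro prod_mono conjI)
      fix p assume "p \<in> Q"
      then have p: "p \<in> P" using finQ by auto
      show "0 \<le> (\<Sum>i\<le>k p. h p i)" using h0[OF p] by (intro sum_nonneg)
      show "(\<Sum>i\<le>k p. h p i) \<le> 1 + (z p - 1) / real p"
        unfolding h_def by (rule sum_prime_weight_le[OF f prime_P[OF p] z[OF p]])
    qed
    also have "\<dots> \<le> (\<Prod>p\<in>P. 1 + (z p - 1) / real p)"
      using finQ finite_P z by (intro prod_mono2) (auto intro!: add_nonneg_nonneg)
    finally show ?thesis .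
  qed
  finally show ?thesis using z
    by (simp add: mult_left_mono prod_nonneg order_trans[OF zero_le_one])
qed

text \<open>Group by \<open>a = v\<^sub>+ <= 1 / b\<close>. One factor of the square comes from the
  sum with \<open>a\<close> fixed, the other from averaging the weights over \<open>a\<close>; the
  length \<open>1 / b\<close> of that range cancels \<open>b\<close>.\<close>

lemma sum_bounded_over_part_le:
  assumes f: "admissible f" and z: "\<And>p. p \<in> P \<Longrightarrow> 1 \<le> z p" and b: "0 < b"
    and U: "finite U" "\<And>v. v \<in> U \<Longrightarrow> smooth v \<and> b * real (over_part P k v) \<le> 1"
  shows "b * (\<Sum>v\<in>U. f v / (real centre * real (over_part P k v)) * (\<Prod>p\<in>P. if multiplicity p v \<noteq> k p then z p else 1))
    \<le> (\<Prod>p\<in>P. 1 + (z p - 1) / real p)\<^sup>2"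
proof -
  define F where "F v = f v / (real centre * real (over_part P k v)) * (\<Prod>p\<in>P. if multiplicity p v \<noteq> k p then z p else 1)" for v
  define T where "T = (\<Prod>p\<in>P. 1 + (z p - 1) / real p)"
  define A where "A = {a. 0 < a \<and> real a \<le> 1 / b}"
  have T0: "0 \<le> T" unfolding T_def using z by (auto intro!: prod_nonneg add_nonneg_nonneg)
  have finA: "finite A" unfolding A_def by (rule finite_subset[of _ "{..nat \<lfloor>1 / b\<rfloor>}"]) (auto simp: le_nat_floor)
  have "over_part P k ` U \<subseteq> A"
    using U(2) b over_part_pos by (auto simp: A_def field_simps)
  then have "sum F U = (\<Sum>a\<in>A. sum F {v \<in> U. over_part P k v = a})"
    using U(1) finA by (intro sum.group[symmetric]) auto
  also have "\<dots> \<le> (\<Sum>a\<in>A. (\<Prod>p\<in>P. if p dvd a then z p else 1) * T)"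
    unfolding F_def T_def using f z U by (intro sum_mono sum_fixed_over_part_le) auto
  also have "\<dots> = (\<Sum>a\<in>A. \<Prod>p\<in>P. if p dvd a then z p else 1) * T" by (simp add: sum_distrib_right)
  also have "\<dots> \<le> (1 / b * T) * T"
    unfolding A_def T_def using finite_P prime_P z b T0[unfolded T_def]
    by (intro mult_right_mono sum_prod_weights_le) auto
  finally have "b * sum F U \<le> b * ((1 / b * T) * T)" using b by (intro mult_left_mono) auto
  then show ?thesis using b by (simp add: F_def[abs_def] T_def[symmetric] power2_eq_square)
qed

text \<open>
  Rankin's trick: insert \<open>exp (\<rho> (s v + s' w - K)) \<ge> 1\<close>. Comparing \<open>\<psi> v * v\<^sub>-\<close> and \<open>\<tau> * b w\<close> after the twist by
  \<open>exp (- \<rho> s)\<close> makes \<open>s' w\<close> cancel, so that only \<open>exp (2 \<rho> s v)\<close> remains to be summed over \<open>v\<close>.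
\<close>

lemma half_sum_le:
  fixes m b s' :: "nat \<Rightarrow> real"
  assumes f: "admissible f" and fin: "finite V" "finite W" "E \<subseteq> V \<times> W"
    and V: "\<And>v. v \<in> V \<Longrightarrow> smooth v" and W: "\<And>w. w \<in> W \<Longrightarrow> 0 \<le> m w \<and> 0 < b w"
    and \<rho>: "0 \<le> \<rho>" and \<tau>: "0 \<le> \<tau>"
    and E: "\<And>v w. (v, w) \<in> E \<Longrightarrow> b w * real (over_part P k v) \<le> 1 \<and> K \<le> real (deviations P t k v) + s' w
        \<and> \<psi> v * real (under_part P k v) * exp (- \<rho> * real (deviations P t k v)) \<le> \<tau> * (b w * exp (- \<rho> * s' w))"
  shows "(\<Sum>(v, w)\<in>E. mu1 f \<psi> v * m w)
    \<le> \<tau> * exp (- \<rho> * K) * (\<Prod>p\<in>P. 1 + ((if real p \<le> t then exp (2 * \<rho>) else 1) - 1) / real p)\<^sup>2 * sum m W"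
proof -
  define s where "s v = real (deviations P t k v)" for v
  define z where "z p = (if real p \<le> t then exp (2 * \<rho>) else 1)" for p :: nat
  define T where "T = (\<Prod>p\<in>P. 1 + (z p - 1) / real p)"
  define F where "F v = f v / (real centre * real (over_part P k v)) * (\<Prod>p\<in>P. if multiplicity p v \<noteq> k p then z p else 1)" for v
  have z1: "1 \<le> z p" for p using \<rho> by (simp add: z_def)
  \<comment> \<open>With this \<open>z\<close> the multiplicative weight of the preceding sums is
    exactly the exponential twist by the number of deviations.\<close>
  have weight: "(\<Prod>p\<in>P. if multiplicity p v \<noteq> k p then z p else 1) = exp (2 * \<rho> * s v)" for v
  proof -
    have "(\<Prod>p\<in>P. if multiplicity p v \<noteq> k p then z p else 1)
        = (\<Prod>p\<in>{p \<in> P. real p \<le> t \<and> multiplicity p v \<noteq> k p}. exp (2 * \<rho>))"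
      using finite_P by (intro prod.mono_neutral_cong_right) (auto simp: z_def)
    then show ?thesis by (simp add: s_def deviations_def exp_of_nat_mult[symmetric] mult_ac)
  qed
  have mu: "mu1 f \<psi> v \<le> \<tau> * b w * exp (- \<rho> * K) * F v" if vw: "(v, w) \<in> E" for v w
  proof -
    have v: "smooth v" using vw fin V by auto
    have "real v * real (under_part P k v) = real centre * real (over_part P k v)"
      using mult_under_part[OF v] by (metis of_nat_mult)
    then have "f v * \<psi> v / real v = f v / (real centre * real (over_part P k v)) * (\<psi> v * real (under_part P k v))"
      using v under_part_pos[of v] by (subst (asm) eq_commute) (simp del: of_nat_prod)
    then have eq: "mu1 f \<psi> v = f v / (real centre * real (over_part P k v)) * (\<psi> v * real (under_part P k v))"
      by (simp add: mu1_def)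
    have "\<psi> v * real (under_part P k v) = \<psi> v * real (under_part P k v) * exp (- \<rho> * s v) * exp (\<rho> * s v)"
      by (simp add: mult.assoc flip: exp_add)
    also have "\<dots> \<le> \<tau> * (b w * exp (- \<rho> * s' w)) * exp (\<rho> * s v)"
      using E[OF vw] by (intro mult_right_mono) (auto simp: s_def)
    also have "\<dots> \<le> \<tau> * (b w * exp (- \<rho> * s' w)) * exp (\<rho> * s v) * exp (\<rho> * (s v + s' w - K))"
    proof -
      have "0 \<le> \<rho> * (s v + s' w - K)" using \<rho> E[OF vw] by (intro mult_nonneg_nonneg) (auto simp: s_def)
      moreover have "0 \<le> \<tau> * (b w * exp (- \<rho> * s' w)) * exp (\<rho> * s v)"
        using \<tau> W[of w] vw fin by auto
      ultimately show ?thesis using mult_left_mono[of 1 "exp (\<rho> * (s v + s' w - K))"] by fastforce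
    qed
    also have "\<dots> = \<tau> * b w * (exp (- \<rho> * s' w) * exp (\<rho> * s v) * exp (\<rho> * (s v + s' w - K)))" by simp
    also have "exp (- \<rho> * s' w) * exp (\<rho> * s v) * exp (\<rho> * (s v + s' w - K)) = exp (- \<rho> * K) * exp (2 * \<rho> * s v)"
      by (simp add: algebra_simps flip: exp_add)
    finally have "\<psi> v * real (under_part P k v) \<le> \<tau> * b w * (exp (- \<rho> * K) * exp (2 * \<rho> * s v))" .
    moreover have "0 \<le> f v / (real centre * real (over_part P k v))"
      using admissible_nonneg[OF f, of v] v by (intro divide_nonneg_nonneg mult_nonneg_nonneg of_nat_0_le_iff) auto
    ultimately show ?thesis unfolding eq F_def weight using mult_left_mono by (fastforce simp: mult_ac)
  qed
  have "(\<Sum>(v, w)\<in>E. mu1 f \<psi> v * m w) \<le> (\<Sum>(v, w)\<in>E. \<tau> * b w * exp (- \<rho> * K) * F v * m w)"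
    using mu W fin by (intro sum_mono) (auto intro!: mult_right_mono)
  \<comment> \<open>For fixed \<open>w\<close> the sum over \<open>v\<close> is taken first, so that
    \<open>b w\<close> meets the range of \<open>v\<^sub>+\<close> that it bounds.\<close>
  also have "\<dots> = (\<Sum>(w, v)\<in>(SIGMA w:W. {v \<in> V. (v, w) \<in> E}). \<tau> * b w * exp (- \<rho> * K) * F v * m w)"
    using fin(3) by (intro sum.reindex_bij_witness[of _ prod.swap prod.swap]) auto
  also have "\<dots> = (\<Sum>w\<in>W. \<tau> * exp (- \<rho> * K) * m w * (b w * (\<Sum>v\<in>{v \<in> V. (v, w) \<in> E}. F v)))"
    using fin by (subst sum.Sigma[symmetric]) (auto simp: sum_distrib_left mult_ac)
  also have "\<dots> \<le> (\<Sum>w\<in>W. \<tau> * exp (- \<rho> * K) * m w * T\<^sup>2)"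
    unfolding F_def T_def using W \<tau> fin V E
    by (intro sum_mono mult_left_mono sum_bounded_over_part_le f z1) auto
  also have "\<dots> = \<tau> * exp (- \<rho> * K) * T\<^sup>2 * sum m W"
    unfolding sum_distrib_left by (intro sum.cong refl) (simp add: mult_ac)
  finally show ?thesis by (simp add: T_def z_def)
qed

end

lemma concentrated_edge_sum_le:
  assumes sys: "gcd_system P t K \<psi> \<theta> V W E" and f: "admissible f" and g: "admissible g" and \<rho>: "0 \<le> \<rho>"
    and conc: "\<And>v w p. (v, w) \<in> E \<Longrightarrow> p \<in> P \<Longrightarrow> multiplicity p v = k p \<or> multiplicity p w = k p"
  shows "(\<Sum>(v, w)\<in>E. mu1 f \<psi> v * mu1 g \<theta> w)
    \<le> 2 * exp (- \<rho> * K) * (\<Prod>p\<in>P. 1 + ((if real p \<le> t then exp (2 * \<rho>) else 1) - 1) / real p)\<^sup>2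
      * sqrt (sum (mu1 f \<psi>) V * sum (mu1 g \<theta>) W)"
proof -
  interpret centred P k t using sys by unfold_locales (auto simp: gcd_system_def)
  define T where "T = (\<Prod>p\<in>P. 1 + ((if real p \<le> t then exp (2 * \<rho>) else 1) - 1) / real p)"
  define MV where "MV = sum (mu1 f \<psi>) V"
  define MW where "MW = sum (mu1 g \<theta>) W"
  define s where "s v = real (deviations P t k v)" for v
  define a where "a v = \<psi> v * real (under_part P k v)" for v
  define b where "b w = \<theta> w * real (under_part P k w)" for w
  have fin: "finite V" "finite W" "E \<subseteq> V \<times> W" using sys by (auto simp: gcd_system_def)
  then have finE: "finite E" by (auto intro: finite_subset)
  have V: "smooth v" "0 < \<psi> v" if "v \<in> V" for v using sys that by (auto simp: gcd_system_def)
  have W: "smooth w" "0 < \<theta> w" if "w \<in> W" for w using sys that by (auto simp: gcd_system_def)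
  have mu_nn: "\<And>v. v \<in> V \<Longrightarrow> 0 \<le> mu1 f \<psi> v" "\<And>w. w \<in> W \<Longrightarrow> 0 \<le> mu1 g \<theta> w"
    using V W f g by (auto intro!: mu1_nonneg)
  have ab: "v \<in> V \<Longrightarrow> 0 < a v" "w \<in> W \<Longrightarrow> 0 < b w" for v w
    using V W under_part_pos by (auto simp: a_def b_def)
  have M0: "0 \<le> MV" "0 \<le> MW" unfolding MV_def MW_def using mu_nn by (auto intro!: sum_nonneg)
  have edge: "a v * real (over_part P k w) \<le> 1" "b w * real (over_part P k v) \<le> 1" "K \<le> s v + s w"
    if vw: "(v, w) \<in> E" for v w
  proof -
    have "v \<in> V" "w \<in> W" using vw fin by auto
    then have sv: "smooth v" "smooth w" using V(1) W(1) by blast+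
    have D: "real w * \<psi> v \<le> real (gcd v w)" "real v * \<theta> w \<le> real (gcd v w)"
      "K \<le> real (card {p \<in> P. real p \<le> t \<and> multiplicity p v \<noteq> multiplicity p w})"
      using sys vw by (auto simp: gcd_system_def)
    have g0: "0 < real (gcd v w)" using sv by simp
    have "real w = real (gcd v w) * (real (under_part P k v) * real (over_part P k w))"
      using gcd_mult_parts[OF sv conc[OF vw]] by (metis of_nat_mult)
    then have "real (gcd v w) * (a v * real (over_part P k w)) \<le> real (gcd v w) * 1"
      using D(1) by (simp add: a_def mult_ac)
    then show "a v * real (over_part P k w) \<le> 1" using g0 by simp
    have "gcd w v * (under_part P k w * over_part P k v) = v"
      using sv conc[OF vw] by (intro gcd_mult_parts) auto
    then have "real v = real (gcd v w) * (real (under_part P k w) * real (over_part P k v))"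
      by (metis gcd.commute of_nat_mult)
    then have "real (gcd v w) * (b w * real (over_part P k v)) \<le> real (gcd v w) * 1"
      using D(2) by (simp add: b_def mult_ac)
    then show "b w * real (over_part P k v) \<le> 1" using g0 by simp
    \<comment> \<open>Where the multiplicities of \<open>v\<close> and \<open>w\<close> differ, at
      least one of them is not \<open>k p\<close>.\<close>
    have "card {p \<in> P. real p \<le> t \<and> multiplicity p v \<noteq> multiplicity p w}
        \<le> card ({p \<in> P. real p \<le> t \<and> multiplicity p v \<noteq> k p} \<union> {p \<in> P. real p \<le> t \<and> multiplicity p w \<noteq> k p})"
      using finite_P by (intro card_mono) auto
    also have "\<dots> \<le> deviations P t k v + deviations P t k w" unfolding deviations_def by (rule card_Un_le)
    finally show "K \<le> s v + s w" using D(3) by (simp add: s_def)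
  qed
  show ?thesis
  proof (cases "MV = 0 \<or> MW = 0")
    case True
    have "mu1 f \<psi> v * mu1 g \<theta> w = 0" if "(v, w) \<in> E" for v w
      using True that fin mu_nn by (auto simp: MV_def MW_def sum_nonneg_eq_0_iff)
    then have "(\<Sum>(v, w)\<in>E. mu1 f \<psi> v * mu1 g \<theta> w) = 0" by (intro sum.neutral) auto
    then show ?thesis using M0 by (simp add: MV_def MW_def)
  next
    case False
    then have M: "0 < MV" "0 < MW" using M0 by auto
    \<comment> \<open>This value balances the halves: \<open>\<tau> * MW\<close> and
      \<open>MV / \<tau>\<close> both equal \<open>sqrt (MV * MW)\<close>.\<close>
    define \<tau> where "\<tau> = sqrt MV / sqrt MW"
    have \<tau>: "0 < \<tau>" using M by (simp add: \<tau>_def)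
    define E1 where "E1 = {(v, w) \<in> E. a v * exp (- \<rho> * s v) \<le> \<tau> * (b w * exp (- \<rho> * s w))}"
    define E2 where "E2 = {(v, w) \<in> E. \<not> a v * exp (- \<rho> * s v) \<le> \<tau> * (b w * exp (- \<rho> * s w))}"
    have "(\<Sum>(v, w)\<in>E1. mu1 f \<psi> v * mu1 g \<theta> w) \<le> \<tau> * exp (- \<rho> * K) * T\<^sup>2 * MW"
      unfolding T_def MW_def
    proof (rule half_sum_le[OF f fin(1,2), where b = b and s' = s])
      show "E1 \<subseteq> V \<times> W" using fin by (auto simp: E1_def)
      fix v w assume vw: "(v, w) \<in> E1"
      then have "(v, w) \<in> E" by (simp add: E1_def)
      from edge[OF this] vw
      show "b w * real (over_part P k v) \<le> 1 \<and> K \<le> real (deviations P t k v) + s w \<and>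
        \<psi> v * real (under_part P k v) * exp (- \<rho> * real (deviations P t k v)) \<le> \<tau> * (b w * exp (- \<rho> * s w))"
        by (simp add: E1_def a_def s_def)
    qed (use V mu_nn ab \<rho> \<tau> in auto)
    moreover have "(\<Sum>(w, v)\<in>prod.swap ` E2. mu1 g \<theta> w * mu1 f \<psi> v) \<le> (1 / \<tau>) * exp (- \<rho> * K) * T\<^sup>2 * MV"
      unfolding T_def MV_def
    proof (rule half_sum_le[OF g fin(2,1), where b = a and s' = s])
      show "prod.swap ` E2 \<subseteq> W \<times> V" using fin by (auto simp: E2_def)
      fix w v assume vw: "(w, v) \<in> prod.swap ` E2"
      then have vwE: "(v, w) \<in> E" and "\<tau> * (b w * exp (- \<rho> * s w)) \<le> a v * exp (- \<rho> * s v)" by (auto simp: E2_def)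
      then have "b w * exp (- \<rho> * s w) \<le> 1 / \<tau> * (a v * exp (- \<rho> * s v))"
        using \<tau> by (simp add: pos_le_divide_eq mult.commute)
      with edge[OF vwE]
      show "a v * real (over_part P k w) \<le> 1 \<and> K \<le> real (deviations P t k w) + s v \<and>
        \<theta> w * real (under_part P k w) * exp (- \<rho> * real (deviations P t k w)) \<le> 1 / \<tau> * (a v * exp (- \<rho> * s v))"
        by (simp add: b_def s_def)
    qed (use W mu_nn ab \<rho> \<tau> in auto)
    moreover have "(\<Sum>(w, v)\<in>prod.swap ` E2. mu1 g \<theta> w * mu1 f \<psi> v) = (\<Sum>(v, w)\<in>E2. mu1 f \<psi> v * mu1 g \<theta> w)"
      by (subst sum.reindex) (auto simp: case_prod_beta mult.commute intro!: sum.cong)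
    moreover have "(\<Sum>(v, w)\<in>E. mu1 f \<psi> v * mu1 g \<theta> w)
        = (\<Sum>(v, w)\<in>E1. mu1 f \<psi> v * mu1 g \<theta> w) + (\<Sum>(v, w)\<in>E2. mu1 f \<psi> v * mu1 g \<theta> w)"
      using finE by (subst sum.union_disjoint[symmetric]) (auto simp: E1_def E2_def intro: finite_subset intro!: sum.cong)
    moreover have "\<tau> * exp (- \<rho> * K) * T\<^sup>2 * MW = exp (- \<rho> * K) * T\<^sup>2 * sqrt (MV * MW)"
      "(1 / \<tau>) * exp (- \<rho> * K) * T\<^sup>2 * MV = exp (- \<rho> * K) * T\<^sup>2 * sqrt (MV * MW)"
    proof -
      have \<tau>M: "\<tau> * MW = sqrt (MV * MW)" "(1 / \<tau>) * MV = sqrt (MV * MW)"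
        using M real_sqrt_mult_self[of MV] real_sqrt_mult_self[of MW]
        by (auto simp: \<tau>_def real_sqrt_mult field_simps)
      show "\<tau> * exp (- \<rho> * K) * T\<^sup>2 * MW = exp (- \<rho> * K) * T\<^sup>2 * sqrt (MV * MW)"
        unfolding \<tau>M(1)[symmetric] by (simp add: mult_ac)
      show "(1 / \<tau>) * exp (- \<rho> * K) * T\<^sup>2 * MV = exp (- \<rho> * K) * T\<^sup>2 * sqrt (MV * MW)"
        unfolding \<tau>M(2)[symmetric] by (simp add: mult_ac)
    qed
    ultimately have "(\<Sum>(v, w)\<in>E. mu1 f \<psi> v * mu1 g \<theta> w) \<le> 2 * (exp (- \<rho> * K) * T\<^sup>2 * sqrt (MV * MW))"
      by linarith
    then show ?thesis by (simp add: T_def MV_def MW_def mult.assoc)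
  qed
qed

section \<open>Interpolation for concentrated systems, then induction on the set of primes\<close>

section \<open>Induction on the primes\<close>

text \<open>The chord of the convex function \<open>exp\<close> from \<open>0\<close> to
  \<open>40 * C\<close>; this introduces the \<open>40\<close> of the final exponent.\<close>

lemma exp_minus_one_le:
  fixes u C :: real
  assumes "0 \<le> u" "u \<le> 40"
  shows "exp (u * C) - 1 \<le> u / 40 * (exp (40 * C) - 1)"
proof -
  have "exp ((1 - u/40) *\<^sub>R 0 + (u/40) *\<^sub>R (40 * C)) \<le> (1 - u/40) * exp 0 + (u/40) * exp (40 * C)"
    using assms by (intro convex_onD[OF exp_convex]) auto
  then show ?thesis by (simp add: algebra_simps)
qed

lemma Logt_ge_1: "1 \<le> Logt t"
  by (simp add: Logt_def)

text \<open>Here \<open>2 * \<kappa> / s <= 9\<close>, so the chord bound applies. Its factor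
  \<open>1 / s\<close> is cancelled by the outer power \<open>s\<close>, which leaves
  \<open>s * (y - 1) <= 9/200 * Y\<close>; the multiples by \<open>10\<close> and \<open>4\<close>
  that occur then stay below \<open>Y\<close> and \<open>Y / 2\<close>.\<close>

lemma prime_product_powr_le:
  assumes t: "1 \<le> t" and P: "finite P" "\<And>p. p \<in> P \<Longrightarrow> prime p" and C: "0 < C"
    and \<kappa>: "0 < \<kappa>" "\<kappa> \<le> 9/10" and s: "1/5 \<le> s" "s \<le> 1"
  shows "((\<Prod>p\<in>P. 1 + ((if real p \<le> t then exp (2 * (\<kappa> * C / s)) else 1) - 1) / real p)\<^sup>2) powr s
    \<le> exp (exp (40 * C) - 1) * Logt t powr ((exp (40 * C) - 1) / 2)"
proof -
  define Y where "Y = exp (40 * C) - 1"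
  define y where "y = exp (2 * (\<kappa> * C / s))"
  define T where "T = (\<Prod>p\<in>P. 1 + ((if real p \<le> t then y else 1) - 1) / real p)"
  have y1: "1 \<le> y" using C \<kappa> s by (simp add: y_def)
  have Y0: "0 \<le> Y" using C by (simp add: Y_def)
  have "2 * \<kappa> / s \<le> 2 * (9/10) / (1/5)" using \<kappa> s by (intro frac_le) auto
  then have "y - 1 \<le> 2 * \<kappa> / s / 40 * Y"
    using exp_minus_one_le[of "2 * \<kappa> / s" C] \<kappa> s by (simp add: y_def Y_def field_simps)
  then have "s * (y - 1) \<le> s * (2 * \<kappa> / s / 40 * Y)" using s by (intro mult_left_mono) auto
  also have "\<dots> = \<kappa> / 20 * Y" using s by simp
  also have "\<dots> \<le> 9/200 * Y" using \<kappa> Y0 by (intro mult_right_mono) auto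
  finally have sy: "s * (y - 1) \<le> 9/200 * Y" .
  have "T \<le> exp (5 * (y - 1)) * Logt t powr (2 * (y - 1))"
    unfolding T_def using t y1 P by (rule prod_one_plus_inverse_primes_le)
  moreover have T0: "0 \<le> T" unfolding T_def using y1 by (intro prod_nonneg) (auto intro!: add_nonneg_nonneg)
  ultimately have "T powr (2 * s) \<le> (exp (5 * (y - 1)) * Logt t powr (2 * (y - 1))) powr (2 * s)"
    using s by (intro powr_mono2) auto
  also have "\<dots> = exp (10 * (s * (y - 1))) * Logt t powr (4 * (s * (y - 1)))"
    using Logt_ge_1[of t] by (simp add: powr_mult powr_powr exp_powr_real algebra_simps)
  also have "\<dots> \<le> exp Y * Logt t powr (Y / 2)"
    using sy Y0 Logt_ge_1[of t] by (intro mult_mono powr_mono) auto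
  also have "T powr (2 * s) = (T\<^sup>2) powr s" using T0 by (simp add: powr_powr flip: powr_realpow' powr_numeral)
  finally show ?thesis unfolding T_def y_def Y_def .
qed

text \<open>Rankin's parameter is taken as \<open>\<kappa> * C / s\<close>, so the power
  \<open>s\<close> of the edge bound contains \<open>exp (- C * K) powr \<kappa>\<close> for every
  \<open>s\<close>. This keeps \<open>s\<close> free for interpolation with the trivial bound
  \<open>S <= M\<close>.\<close>

lemma concentrated_edge_sum_powr_le:
  assumes sys: "gcd_system P t K \<psi> \<theta> V W E" and f: "admissible f" and g: "admissible g"
    and t: "1 \<le> t" and C: "0 < C" and \<kappa>: "1/2 < \<kappa>" "\<kappa> \<le> 9/10"
    and conc: "\<And>v w p. (v, w) \<in> E \<Longrightarrow> p \<in> P \<Longrightarrow> multiplicity p v = k p \<or> multiplicity p w = k p"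
  shows "(\<Sum>(v, w)\<in>E. mu1 f \<psi> v * mu1 g \<theta> w)
    \<le> 2 * exp (exp (40 * C) - 1) * Logt t powr ((exp (40 * C) - 1) / 2)
      * (sum (mu1 f \<psi>) V * sum (mu1 g \<theta>) W * exp (- C * K)) powr \<kappa>"
proof -
  define H where "H = exp (exp (40 * C) - 1) * Logt t powr ((exp (40 * C) - 1) / 2)"
  define M where "M = sum (mu1 f \<psi>) V * sum (mu1 g \<theta>) W"
  define S where "S = (\<Sum>(v, w)\<in>E. mu1 f \<psi> v * mu1 g \<theta> w)"
  have fin: "finite V" "finite W" "E \<subseteq> V \<times> W" using sys by (auto simp: gcd_system_def)
  have mu_nn: "\<And>v. v \<in> V \<Longrightarrow> 0 \<le> mu1 f \<psi> v" "\<And>w. w \<in> W \<Longrightarrow> 0 \<le> mu1 g \<theta> w"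
    using sys f g by (auto intro!: mu1_nonneg simp: gcd_system_def)
  have M0: "0 \<le> M" unfolding M_def using mu_nn by (auto intro!: sum_nonneg mult_nonneg_nonneg)
  have S0: "0 \<le> S" unfolding S_def using mu_nn fin by (intro sum_nonneg) auto
  have "S \<le> (\<Sum>(v, w)\<in>V \<times> W. mu1 f \<psi> v * mu1 g \<theta> w)"
    unfolding S_def using fin mu_nn by (intro sum_mono2) auto
  also have "\<dots> = M" by (simp add: M_def sum_product sum.cartesian_product)
  finally have SM: "S \<le> M" .
  have P: "finite P" "\<And>p. p \<in> P \<Longrightarrow> prime p" using sys by (auto simp: gcd_system_def)
  have H0: "0 \<le> H" by (simp add: H_def)
  have key: "S powr s \<le> 2 * H * exp (- C * K) powr \<kappa> * M powr (s / 2)" if s: "1/5 \<le> s" "s \<le> 1" for s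
  proof -
    define T where "T = (\<Prod>p\<in>P. 1 + ((if real p \<le> t then exp (2 * (\<kappa> * C / s)) else 1) - 1) / real p)"
    have "S \<le> 2 * exp (- (\<kappa> * C / s) * K) * T\<^sup>2 * sqrt M"
      unfolding S_def T_def M_def using C \<kappa> s
      by (intro concentrated_edge_sum_le[OF sys f g _ conc]) auto
    then have "S powr s \<le> (2 * exp (- (\<kappa> * C / s) * K) * T\<^sup>2 * sqrt M) powr s"
      using S0 s by (intro powr_mono2) auto
    also have "\<dots> = 2 powr s * exp (- (\<kappa> * C / s) * K) powr s * (T\<^sup>2) powr s * (sqrt M) powr s"
      by (simp add: powr_mult)
    also have "exp (- (\<kappa> * C / s) * K) powr s = exp (- C * K) powr \<kappa>"
      using s by (simp add: exp_powr_real)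
    also have "(sqrt M) powr s = M powr (s / 2)"
      using M0 by (simp add: powr_half_sqrt[symmetric] powr_powr)
    also have "2 powr s * exp (- C * K) powr \<kappa> * (T\<^sup>2) powr s * M powr (s / 2)
        \<le> 2 * exp (- C * K) powr \<kappa> * H * M powr (s / 2)"
    proof -
      have "(T\<^sup>2) powr s \<le> H"
        unfolding T_def H_def using \<kappa> by (intro prime_product_powr_le[OF t P C _ \<kappa>(2) s]) auto
      moreover have "2 powr s \<le> (2::real)" using s powr_mono[of s 1 "2::real"] by simp
      ultimately show ?thesis using H0 by (intro mult_mono) auto
    qed
    finally show ?thesis by (simp add: mult_ac)
  qed
  have "S \<le> 2 * H * exp (- C * K) powr \<kappa> * M powr \<kappa>"
  proof (cases "M \<ge> 1")
    case True
    have "S \<le> 2 * H * exp (- C * K) powr \<kappa> * M powr (1/2)" using key[of 1] S0 by simp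
    also have "\<dots> \<le> 2 * H * exp (- C * K) powr \<kappa> * M powr \<kappa>"
      using True \<kappa> H0 by (intro mult_left_mono powr_mono) auto
    finally show ?thesis .
  next
    case False
    \<comment> \<open>The solution of \<open>(1 - s) + s / 2 = \<kappa>\<close>; it is at least
      \<open>1/5\<close> because \<kappa> \<open><= 9/10\<close>.\<close>
    define s where "s = 2 * (1 - \<kappa>)"
    have s: "1/5 \<le> s" "s < 1" using \<kappa> by (auto simp: s_def)
    have "S = S powr (1 - s) * S powr s" using S0 by (simp flip: powr_add)
    also have "\<dots> \<le> M powr (1 - s) * (2 * H * exp (- C * K) powr \<kappa> * M powr (s / 2))"
      using key[of s] s S0 SM by (intro mult_mono powr_mono2) auto
    also have "\<dots> = 2 * H * exp (- C * K) powr \<kappa> * (M powr (1 - s) * M powr (s / 2))" by simp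
    also have "M powr (1 - s) * M powr (s / 2) = M powr \<kappa>" by (simp add: s_def diff_divide_distrib flip: powr_add)
    finally show ?thesis .
  qed
  then show ?thesis by (simp add: S_def H_def M_def powr_mult mult_ac)
qed

lemma gcd_system_subset:
  "gcd_system P t K \<psi> \<theta> V W E \<Longrightarrow> E' \<subseteq> E \<Longrightarrow> gcd_system P t K \<psi> \<theta> V W E'"
  by (auto simp: gcd_system_def)

lemma sum_le_sum_plus_exceptions:
  fixes h :: "'a \<Rightarrow> real"
  assumes "finite E" "finite P" "\<And>e. e \<in> E \<Longrightarrow> 0 \<le> h e"
  shows "sum h E \<le> sum h {e \<in> E. \<forall>p\<in>P. R p e} + (\<Sum>p\<in>P. sum h {e \<in> E. \<not> R p e})"
proof -
  have "E = {e \<in> E. \<forall>p\<in>P. R p e} \<union> (\<Union>p\<in>P. {e \<in> E. \<not> R p e})" by auto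
  then have "sum h E = sum h ({e \<in> E. \<forall>p\<in>P. R p e} \<union> (\<Union>p\<in>P. {e \<in> E. \<not> R p e}))" by simp
  also have "\<dots> \<le> sum h {e \<in> E. \<forall>p\<in>P. R p e} + sum h (\<Union>p\<in>P. {e \<in> E. \<not> R p e})"
    using assms by (subst sum.union_disjoint) auto
  also have "sum h (\<Union>p\<in>P. {e \<in> E. \<not> R p e}) \<le> (\<Sum>p\<in>P. sum h {e \<in> E. \<not> R p e})"
    using assms(2)
  proof (induction P rule: finite_induct)
    case (insert p P)
    have "sum h (\<Union>p\<in>insert p P. {e \<in> E. \<not> R p e})
        \<le> sum h {e \<in> E. \<not> R p e} + sum h (\<Union>p\<in>P. {e \<in> E. \<not> R p e})"
      using assms(1,3) sum_nonneg[of "{e \<in> E. \<not> R p e} \<inter> (\<Union>p\<in>P. {e \<in> E. \<not> R p e})" h]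
      by (simp add: sum_Un insert.hyps)
    then show ?case using insert by simp
  qed simp
  finally show ?thesis by simp
qed

text \<open>Primes up to \<open>p0\<close> are removed first, each at the price
  \<open>100 * exp C\<close>. Once only large primes remain the constant must not grow: all sets
  \<open>P - {p}\<close> then have the bound with the same \<open>A\<close>, and a failure for
  \<open>P\<close> would force concentration at every prime.\<close>

lemma edge_bound_all:
  assumes f: "admissible f" and g: "admissible g" and t: "1 \<le> t" and C: "0 < C"
    and e: "0 < \<epsilon>" "\<epsilon> \<le> 2/5" and \<kappa>: "\<kappa> = 1/2 + \<epsilon>" and L: "L = exp (C * \<kappa>)"
    and small: "\<And>p. prime p \<Longrightarrow> p0 < real p \<Longrightarrow> 4 * L * real p powr - (1 - \<kappa>) \<le> 1
        \<and> (4 * L * real p powr - (1 - \<kappa>) / \<epsilon>) powr (2 * \<epsilon>) \<le> 1/4"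
    and tail: "\<And>P. finite P \<Longrightarrow> (\<And>p. p \<in> P \<Longrightarrow> p0 < real p) \<Longrightarrow>
        (\<Sum>p\<in>P. 2 * (48 * L) powr (2 * \<kappa> / (1 - \<kappa>)) * real p powr (- 2 * \<kappa>)) \<le> 1/2"
    and A: "4 * exp (exp (40 * C) - 1) * Logt t powr ((exp (40 * C) - 1) / 2) \<le> A"
    and P: "finite P" "\<And>p. p \<in> P \<Longrightarrow> prime p"
  shows "edge_bound f g t C \<kappa> P (A * (100 * exp C) ^ card {p \<in> P. real p \<le> p0})"
  using P
proof (induction P rule: finite_psubset_induct)
  case (psubset P)
  have A0: "0 \<le> A" using A by (smt (verit) exp_gt_zero mult_nonneg_nonneg powr_ge_zero)
  have \<kappa>1: "1/2 < \<kappa>" "\<kappa> \<le> 9/10" using e \<kappa> by auto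
  show ?case
  proof (cases "\<exists>p\<in>P. real p \<le> p0")
    case True
    then obtain p where p: "p \<in> P" "real p \<le> p0" by blast
    have "edge_bound f g t C \<kappa> (P - {p}) (A * (100 * exp C) ^ card {q \<in> P - {p}. real q \<le> p0})"
      using p psubset by (intro psubset.IH) auto
    then have "edge_bound f g t C \<kappa> P (100 * exp C * (A * (100 * exp C) ^ card {q \<in> P - {p}. real q \<le> p0}))"
      using psubset.prems[OF p(1)] \<kappa>1 A0 by (intro edge_bound_small_prime[OF _ _ f g _ _ C]) auto
    moreover have "{q \<in> P. real q \<le> p0} = insert p {q \<in> P - {p}. real q \<le> p0}" using p by auto
    ultimately show ?thesis using psubset.hyps by (simp add: mult_ac)
  next
    case False
    have IH: "edge_bound f g t C \<kappa> (P - {p}) A" if "p \<in> P" for p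
    proof -
      have none: "{q \<in> P - {p}. real q \<le> p0} = {}" using False by auto
      have "edge_bound f g t C \<kappa> (P - {p}) (A * (100 * exp C) ^ card {q \<in> P - {p}. real q \<le> p0})"
        using psubset.prems that by (intro psubset.IH) auto
      then show ?thesis unfolding none by simp
    qed
    have "edge_bound f g t C \<kappa> P A"
      unfolding edge_bound_def
    proof (intro allI impI, rule ccontr)
      fix \<psi> \<theta> V W E K
      assume sys: "gcd_system P t K \<psi> \<theta> V W E"
      define h where "h = (\<lambda>(v, w). mu1 f \<psi> v * mu1 g \<theta> w)"
      define Z where "Z = (sum (mu1 f \<psi>) V * sum (mu1 g \<theta>) W * exp (- C * K)) powr \<kappa>"
      define c where "c p = 2 * (48 * L) powr (2 * \<kappa> / (1 - \<kappa>)) * real p powr (- 2 * \<kappa>)" for p :: nat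
      assume "\<not> (\<Sum>(v, w)\<in>E. mu1 f \<psi> v * mu1 g \<theta> w)
         \<le> A * (sum (mu1 f \<psi>) V * sum (mu1 g \<theta>) W * exp (- C * K)) powr \<kappa>"
      then have contra: "A * Z < sum h E" by (simp add: h_def Z_def)
      \<comment> \<open>The assumed failure excludes the first alternative of the dichotomy at every
        \<open>p\<close>.\<close>
      have "\<forall>p\<in>P. \<exists>k. sum h {(v, w) \<in> E. multiplicity p v \<noteq> k \<and> multiplicity p w \<noteq> k} \<le> c p * (A * Z)"
      proof
        fix p assume p: "p \<in> P"
        have "prime p" "p0 < real p" using p psubset.prems False by auto
        then have "sum h E \<le> A * Z
          \<or> (\<exists>k. sum h {(v, w) \<in> E. multiplicity p v \<noteq> k \<and> multiplicity p w \<noteq> k} \<le> c p * (A * Z))"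
          unfolding h_def c_def Z_def using e small[of p]
          by (intro edge_bound_large_prime[OF IH[OF p] sys _ f g e(1) _ \<kappa> C A0 L refl]) auto
        then show "\<exists>k. sum h {(v, w) \<in> E. multiplicity p v \<noteq> k \<and> multiplicity p w \<noteq> k} \<le> c p * (A * Z)"
          using contra by (simp only: not_le[symmetric] simp_thms)
      qed
      then obtain k where k: "\<forall>p\<in>P.
          sum h {(v, w) \<in> E. multiplicity p v \<noteq> k p \<and> multiplicity p w \<noteq> k p} \<le> c p * (A * Z)"
        by (rule bchoice[THEN exE])
      define R where "R p = (\<lambda>(v, w). multiplicity p v = k p \<or> multiplicity p w = k p)" for p
      have fin: "finite E" "finite P" using sys by (auto simp: gcd_system_def intro: finite_subset)
      have h0: "0 \<le> h e" if "e \<in> E" for e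
        using that sys f g by (auto simp: h_def gcd_system_def intro!: mult_nonneg_nonneg mu1_nonneg)
      have "sum h E \<le> sum h {e \<in> E. \<forall>p\<in>P. R p e} + (\<Sum>p\<in>P. sum h {e \<in> E. \<not> R p e})"
        using fin h0 by (rule sum_le_sum_plus_exceptions)
      \<comment> \<open>The concentrated edges use up half of \<open>A\<close>, hence the
        \<open>4\<close> in the hypothesis on \<open>A\<close> against the \<open>2\<close> in the
        concentrated bound. The other half is left for the exceptional edges, controlled by the tail
        sum.\<close>
      also have "sum h {e \<in> E. \<forall>p\<in>P. R p e} \<le> A / 2 * Z"
      proof -
        have "sum h {e \<in> E. \<forall>p\<in>P. R p e} \<le> 2 * exp (exp (40 * C) - 1) * Logt t powr ((exp (40 * C) - 1) / 2) * Z"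
          unfolding h_def Z_def
          by (rule concentrated_edge_sum_powr_le[OF gcd_system_subset[OF sys] f g t C \<kappa>1])
            (auto simp: R_def)
        also have "\<dots> \<le> A / 2 * Z" using A by (intro mult_right_mono) (auto simp: Z_def)
        finally show ?thesis .
      qed
      also have "(\<Sum>p\<in>P. sum h {e \<in> E. \<not> R p e}) \<le> (\<Sum>p\<in>P. c p * (A * Z))"
      proof (rule sum_mono)
        fix p assume "p \<in> P"
        moreover have "{e \<in> E. \<not> R p e} = {(v, w) \<in> E. multiplicity p v \<noteq> k p \<and> multiplicity p w \<noteq> k p}"
          by (auto simp: R_def)
        ultimately show "sum h {e \<in> E. \<not> R p e} \<le> c p * (A * Z)" using k by simp
      qed
      also have "\<dots> = (\<Sum>p\<in>P. c p) * (A * Z)" by (simp add: sum_distrib_right)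
      also have "\<dots> \<le> 1/2 * (A * Z)"
        using tail[OF fin(2)] False A0 unfolding c_def by (intro mult_right_mono) (auto simp: Z_def not_le)
      finally show False using contra by simp
    qed
    moreover have none: "{p \<in> P. real p \<le> p0} = {}" using False by auto
    ultimately show ?thesis unfolding none by simp
  qed
qed


section \<open>Choice of the threshold and return to the original notation\<close>

text \<open>The tail is available since \<open>2 * \<kappa> > 1\<close>. The condition on
  \<open>M\<close> lets \<open>b powr p0\<close> swallow an absolute constant, which is the purpose
  of the summand \<open>p0\<close> in the final exponent.\<close>

lemma large_threshold_exists:
  fixes \<epsilon> \<kappa> L c M :: real
  assumes e: "0 < \<epsilon>" "\<epsilon> < 1/2" and \<kappa>: "\<kappa> = 1/2 + \<epsilon>" and L: "0 < L" and c: "0 \<le> c" and b: "1 < b"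
  obtains p0 :: real where "0 < p0" "M \<le> b powr p0"
    "\<And>p. p0 < real p \<Longrightarrow> 4 * L * real p powr - (1 - \<kappa>) \<le> 1
        \<and> (4 * L * real p powr - (1 - \<kappa>) / \<epsilon>) powr (2 * \<epsilon>) \<le> 1/4"
    "\<And>P. finite P \<Longrightarrow> (\<And>p. p \<in> P \<Longrightarrow> p0 < real p) \<Longrightarrow> (\<Sum>p\<in>P. c * real p powr (- 2 * \<kappa>)) \<le> 1/2"
proof -
  \<comment> \<open>The two smallness conditions on \<open>q = p powr - (1 - \<kappa>)\<close>,
    solved for \<open>q\<close>.\<close>
  define \<delta> where "\<delta> = min (1 / (4 * L)) (\<epsilon> / (4 * L) * (1/4) powr (1 / (2 * \<epsilon>)))"
  have \<delta>: "0 < \<delta>" using L e by (simp add: \<delta>_def)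
  have "((\<lambda>x::real. x powr - (1 - \<kappa>)) \<longlongrightarrow> 0) at_top"
    using e \<kappa> by (intro tendsto_neg_powr filterlim_ident) auto
  then have "\<forall>\<^sub>F x::real in at_top. x powr - (1 - \<kappa>) < \<delta>" using \<delta> by (rule order_tendstoD)
  then obtain x1 where x1: "\<And>x. x \<ge> x1 \<Longrightarrow> x powr - (1 - \<kappa>) < \<delta>"
    by (auto simp: eventually_at_top_linorder)
  have sm: "summable (\<lambda>n. c * real n powr (- 2 * \<kappa>))"
    using e \<kappa> by (intro summable_mult) (simp add: summable_real_powr_iff)
  then obtain n1 where n1: "\<And>n. n \<ge> n1 \<Longrightarrow> norm (\<Sum>i. c * real (i + n) powr (- 2 * \<kappa>)) < 1/2"
    using suminf_exist_split[of "1/2" "\<lambda>n. c * real n powr (- 2 * \<kappa>)"] by auto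
  define p0 where "p0 = Max {1, x1, real n1, log b M}"
  have p0: "1 \<le> p0" "x1 \<le> p0" "real n1 \<le> p0" "log b M \<le> p0" by (simp_all add: p0_def)
  show thesis
  proof (rule that[of p0])
    show "0 < p0" using p0 by simp
    show "M \<le> b powr p0"
    proof (cases "0 < M")
      case True
      then show ?thesis using p0(4) b by (simp add: log_le_iff)
    next
      case False
      then show ?thesis using powr_ge_zero[of b p0] by linarith
    qed
  next
    fix p :: nat assume p: "p0 < real p"
    define q where "q = real p powr - (1 - \<kappa>)"
    have q: "0 \<le> q" "q < \<delta>" using x1[of "real p"] p p0 by (auto simp: q_def)
    have 1: "4 * L * q \<le> 1" using q L by (simp add: \<delta>_def field_simps)
    have "q \<le> \<epsilon> / (4 * L) * (1/4) powr (1 / (2 * \<epsilon>))" using q by (simp add: \<delta>_def)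
    then have "4 * L * q / \<epsilon> \<le> (1/4) powr (1 / (2 * \<epsilon>))" using L e by (simp add: field_simps)
    then have "(4 * L * q / \<epsilon>) powr (2 * \<epsilon>) \<le> ((1/4) powr (1 / (2 * \<epsilon>))) powr (2 * \<epsilon>)"
      using q L e by (intro powr_mono2) auto
    also have "\<dots> = 1/4" using e by (simp add: powr_powr)
    finally show "4 * L * real p powr - (1 - \<kappa>) \<le> 1 \<and> (4 * L * real p powr - (1 - \<kappa>) / \<epsilon>) powr (2 * \<epsilon>) \<le> 1/4"
      using 1 by (simp add: q_def)
  next
    fix P :: "nat set" assume P: "finite P" "\<And>p. p \<in> P \<Longrightarrow> p0 < real p"
    have ge: "n1 \<le> p" if "p \<in> P" for p using P(2)[OF that] p0(3) by linarith
    have "(\<Sum>p\<in>P. c * real p powr (- 2 * \<kappa>)) = (\<Sum>i\<in>(\<lambda>p. p - n1) ` P. c * real (i + n1) powr (- 2 * \<kappa>))"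
    proof (subst sum.reindex)
      show "inj_on (\<lambda>p. p - n1) P"
      proof (rule inj_onI)
        fix x y assume "x \<in> P" "y \<in> P" "x - n1 = y - n1"
        then show "x = y" using ge[of x] ge[of y] by linarith
      qed
    qed (use ge in \<open>auto intro!: sum.cong\<close>)
    also have "\<dots> \<le> (\<Sum>i. c * real (i + n1) powr (- 2 * \<kappa>))"
      using summable_ignore_initial_segment[OF sm, of n1] P c by (intro sum_le_suminf) auto
    also have "\<dots> \<le> 1/2" using n1[of n1] by simp
    finally show "(\<Sum>p\<in>P. c * real p powr (- 2 * \<kappa>)) \<le> 1/2" .
  qed
qed

text \<open>With \<open>a\<close>, \<open>b\<close> the multiplicities of \<open>p\<close> in
  \<open>v\<close>, \<open>w\<close>, the quotient contains \<open>p\<close> exactly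
  \<open>a + b - 2 * min a b\<close> times, which is \<open>0\<close> if \<open>a = b\<close>. An
  inequality is enough, as the count only has to stay above \<open>K\<close>.\<close>

lemma omega_t_le:
  assumes "0 < v" "0 < w" "finite P" "\<And>p. prime p \<Longrightarrow> p dvd v * w \<Longrightarrow> p \<in> P"
  shows "omega_t t v w \<le> card {p \<in> P. real p \<le> t \<and> multiplicity p v \<noteq> multiplicity p w}"
  unfolding omega_t_def
proof (intro card_mono subsetI)
  fix p assume "p \<in> {p. prime p \<and> real p \<le> t \<and> p dvd v * w div (gcd v w)\<^sup>2}"
  then have p: "prime p" "real p \<le> t" "p dvd v * w div (gcd v w)\<^sup>2" by auto
  have "(gcd v w)\<^sup>2 dvd v * w" by (simp add: power2_eq_square mult_dvd_mono)
  then have vw: "v * w = v * w div (gcd v w)\<^sup>2 * (gcd v w)\<^sup>2" by simp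
  then have n0: "v * w div (gcd v w)\<^sup>2 \<noteq> 0" using assms by (metis mult_is_0 neq0_conv)
  have "p dvd v * w" using p(3) vw by (metis dvd_mult2)
  then have "p \<in> P" using assms p by blast
  moreover have "multiplicity p v \<noteq> multiplicity p w"
  proof
    assume eq: "multiplicity p v = multiplicity p w"
    have pe: "prime_elem p" using p by auto
    have "multiplicity p v + multiplicity p w = multiplicity p (v * w)"
      using assms by (intro prime_elem_multiplicity_mult_distrib[OF pe, symmetric]) auto
    also have "\<dots> = multiplicity p (v * w div (gcd v w)\<^sup>2) + multiplicity p ((gcd v w)\<^sup>2)"
      using assms n0 by (subst vw, intro prime_elem_multiplicity_mult_distrib[OF pe]) auto
    also have "multiplicity p ((gcd v w)\<^sup>2) = 2 * min (multiplicity p v) (multiplicity p w)"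
      using assms p by (subst prime_elem_multiplicity_power_distrib[OF pe]) (auto simp: multiplicity_gcd)
    finally have "multiplicity p (v * w div (gcd v w)\<^sup>2) = 0" using eq by simp
    then show False using p n0 by (auto simp: prime_elem_multiplicity_eq_zero_iff[OF pe])
  qed
  ultimately show "p \<in> {p \<in> P. real p \<le> t \<and> multiplicity p v \<noteq> multiplicity p w}" using p by simp
qed (use assms in auto)

lemma muset_eq_sum:
  assumes "finite (supp_nat \<psi>)" "0 \<notin> V"
  shows "muset f \<psi> V = sum (mu1 f \<psi>) (V \<inter> supp_nat \<psi>)"
proof -
  have "muset f \<psi> V = infsum (mu1 f \<psi>) (V \<inter> supp_nat \<psi>)"
    unfolding muset_def
  proof (rule infsum_cong_neutral)
    fix v assume "v \<in> V - V \<inter> supp_nat \<psi>"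
    then show "mu1 f \<psi> v = 0" using assms(2) by (cases v) (auto simp: supp_nat_def mu1_def)
  qed auto
  then show ?thesis using assms by simp
qed

theorem theorem1p7:
  fixes \<epsilon> C :: real
  assumes "0 < \<epsilon>" "\<epsilon> \<le> 2/5" "0 < C"
  shows "\<exists>p0::real. p0 > 0 \<and>
    (\<forall>(\<psi>::nat \<Rightarrow> real) (\<theta>::nat \<Rightarrow> real) (f::nat \<Rightarrow> real) (g::nat \<Rightarrow> real)
       (V::nat set) (W::nat set) (t::real) (K::real) (E::(nat \<times> nat) set).
      (\<forall>n\<ge>1. \<psi> n \<ge> 0) \<longrightarrow> (\<forall>n\<ge>1. \<theta> n \<ge> 0) \<longrightarrow>
      finite (supp_nat \<psi>) \<longrightarrow> finite (supp_nat \<theta>) \<longrightarrow>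
      (\<forall>n\<ge>1. f n \<ge> 0) \<longrightarrow> (\<forall>n\<ge>1. g n \<ge> 0) \<longrightarrow>
      multiplicative f \<longrightarrow> multiplicative g \<longrightarrow>
      (\<forall>n\<ge>1. dconv1 f n \<le> real n) \<longrightarrow> (\<forall>n\<ge>1. dconv1 g n \<le> real n) \<longrightarrow>
      0 \<notin> V \<longrightarrow> 0 \<notin> W \<longrightarrow> t \<ge> 1 \<longrightarrow>
      E \<subseteq> Eset \<psi> \<theta> t K \<inter> (V \<times> W) \<longrightarrow>
      mupair f g \<psi> \<theta> E \<le>
        (100 * exp C) powr (p0 + real (card (Pset \<psi> \<theta> \<inter> {p. real p \<le> p0})))
        * (Logt t) powr ((exp (40 * C) - 1) / 2)
        * (muset f \<psi> V * muset g \<theta> W * exp (- C * K)) powr (1/2 + \<epsilon>))"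
proof -
  define \<kappa> where "\<kappa> = 1/2 + \<epsilon>"
  define L where "L = exp (C * \<kappa>)"
  define b where "b = 100 * exp C"
  have "1 < 100 * exp C" using assms(3) one_le_exp_iff[of C] by linarith
  then have b: "1 < b" by (simp add: b_def)
  have e2: "\<epsilon> < 1/2" using assms by simp
  have L0: "0 < L" by (simp add: L_def)
  \<comment> \<open>The constant from the induction is handed over as the \<open>M\<close> to be
    absorbed by \<open>b powr p0\<close>.\<close>
  obtain p0 :: real where p0: "0 < p0" "4 * exp (exp (40 * C) - 1) \<le> b powr p0"
    and small: "\<And>p. p0 < real p \<Longrightarrow> 4 * L * real p powr - (1 - \<kappa>) \<le> 1
        \<and> (4 * L * real p powr - (1 - \<kappa>) / \<epsilon>) powr (2 * \<epsilon>) \<le> 1/4"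
    and tail: "\<And>P. finite P \<Longrightarrow> (\<And>p. p \<in> P \<Longrightarrow> p0 < real p) \<Longrightarrow>
        (\<Sum>p\<in>P. 2 * (48 * L) powr (2 * \<kappa> / (1 - \<kappa>)) * real p powr (- 2 * \<kappa>)) \<le> 1/2"
    by (rule large_threshold_exists[OF assms(1) e2 \<kappa>_def L0 _ b,
          of "2 * (48 * L) powr (2 * \<kappa> / (1 - \<kappa>))" "4 * exp (exp (40 * C) - 1)"]) auto
  show ?thesis
  proof (intro exI[of _ p0] conjI allI impI)
    show "0 < p0" by fact
    fix \<psi> \<theta> f g :: "nat \<Rightarrow> real" and V W :: "nat set" and t K :: real and E :: "(nat \<times> nat) set"
    assume \<psi>: "\<forall>n\<ge>1. \<psi> n \<ge> 0" "\<forall>n\<ge>1. \<theta> n \<ge> 0"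
      and supp: "finite (supp_nat \<psi>)" "finite (supp_nat \<theta>)"
      and "\<forall>n\<ge>1. f n \<ge> 0" "\<forall>n\<ge>1. g n \<ge> 0" "multiplicative f" "multiplicative g"
        "\<forall>n\<ge>1. dconv1 f n \<le> real n" "\<forall>n\<ge>1. dconv1 g n \<le> real n"
      and VW: "0 \<notin> V" "0 \<notin> W" and t: "t \<ge> 1" and E: "E \<subseteq> Eset \<psi> \<theta> t K \<inter> (V \<times> W)"
    then have f: "admissible f" and g: "admissible g" by (auto simp: admissible_def)
    define P where "P = Pset \<psi> \<theta>"
    define V' where "V' = V \<inter> supp_nat \<psi>"
    define W' where "W' = W \<inter> supp_nat \<theta>"
    have EVW: "E \<subseteq> V' \<times> W'" using E by (auto simp: V'_def W'_def Eset_def)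
    have fin: "finite V'" "finite W'" using supp by (auto simp: V'_def W'_def)
    then have "finite E" using EVW by (auto intro: finite_subset)
    then have mE: "mupair f g \<psi> \<theta> E = (\<Sum>(v, w)\<in>E. mu1 f \<psi> v * mu1 g \<theta> w)" by (simp add: mupair_def)
    have mV: "muset f \<psi> V = sum (mu1 f \<psi>) V'" unfolding V'_def using supp VW by (intro muset_eq_sum)
    have mW: "muset g \<theta> W = sum (mu1 g \<theta>) W'" unfolding W'_def using supp VW by (intro muset_eq_sum)
    show "mupair f g \<psi> \<theta> E \<le>
        (100 * exp C) powr (p0 + real (card (Pset \<psi> \<theta> \<inter> {p. real p \<le> p0})))
        * (Logt t) powr ((exp (40 * C) - 1) / 2)
        * (muset f \<psi> V * muset g \<theta> W * exp (- C * K)) powr (1/2 + \<epsilon>)"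
    proof (cases "E = {}")
      case True
      then have "mupair f g \<psi> \<theta> E = 0" by (simp add: mupair_def)
      then show ?thesis by simp
    next
      case False
      \<comment> \<open>An edge supplies a vertex in each support. Since \<open>Pset\<close> speaks
        of divisors of products, a prime factor of a single \<open>v\<close> is recognised through
        \<open>v * w0\<close>, and one of \<open>w\<close> through \<open>v0 * w\<close>.\<close>
      then obtain v0 w0 where v0: "v0 \<in> supp_nat \<psi>" "w0 \<in> supp_nat \<theta>"
        using EVW by (auto simp: V'_def W'_def)
      have "P \<subseteq> (\<Union>v\<in>supp_nat \<psi>. \<Union>w\<in>supp_nat \<theta>. prime_factors (v * w))"
        by (auto simp: P_def Pset_def supp_nat_def prime_factors_dvd)
      then have finP: "finite P" by (rule finite_subset) (use supp in auto)
      have primeP: "prime p" if "p \<in> P" for p using that by (simp add: P_def Pset_def)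
      have sys: "gcd_system P t K \<psi> \<theta> V' W' E"
        unfolding gcd_system_def
      proof (intro conjI ballI)
        fix v assume v: "v \<in> V'"
        then have "1 \<le> v" "\<psi> v \<noteq> 0" by (auto simp: V'_def supp_nat_def)
        then show "0 < v" "0 < \<psi> v" using \<psi>(1)[rule_format, of v] by auto
        show "prime_factors v \<subseteq> P"
        proof
          fix p assume "p \<in> prime_factors v"
          then have "prime p" "p dvd v * w0" by auto
          then show "p \<in> P" using v v0 unfolding P_def Pset_def V'_def by blast
        qed
      next
        fix w assume w: "w \<in> W'"
        then have "1 \<le> w" "\<theta> w \<noteq> 0" by (auto simp: W'_def supp_nat_def)
        then show "0 < w" "0 < \<theta> w" using \<psi>(2)[rule_format, of w] by auto
        show "prime_factors w \<subseteq> P"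
        proof
          fix p assume "p \<in> prime_factors w"
          then have "prime p" "p dvd v0 * w" by auto
          then show "p \<in> P" using w v0 unfolding P_def Pset_def W'_def by blast
        qed
      next
        fix e assume e: "e \<in> E"
        obtain v w where vw: "e = (v, w)" by (cases e)
        have *: "v \<in> supp_nat \<psi>" "w \<in> supp_nat \<theta>" "Dpt \<psi> \<theta> v w \<le> 1" "K \<le> real (omega_t t v w)"
          using e E vw by (auto simp: Eset_def)
        then have pos: "0 < v" "0 < w" by (auto simp: supp_nat_def)
        have "max (real w * \<psi> v) (real v * \<theta> w) \<le> real (gcd v w)"
          using *(3) pos by (simp add: Dpt_def divide_le_eq)
        moreover have "omega_t t v w \<le> card {p \<in> P. real p \<le> t \<and> multiplicity p v \<noteq> multiplicity p w}"
          using pos finP * by (intro omega_t_le) (auto simp: P_def Pset_def)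
        ultimately show "case e of (v, w) \<Rightarrow> real w * \<psi> v \<le> real (gcd v w) \<and> real v * \<theta> w \<le> real (gcd v w)
            \<and> K \<le> real (card {p \<in> P. real p \<le> t \<and> multiplicity p v \<noteq> multiplicity p w})"
          using *(4) vw by auto
      qed (use finP primeP fin EVW in auto)
      define H where "H = Logt t powr ((exp (40 * C) - 1) / 2)"
      have "edge_bound f g t C \<kappa> P (b powr p0 * H * (100 * exp C) ^ card {p \<in> P. real p \<le> p0})"
      proof (rule edge_bound_all[OF f g t assms(3) assms(1,2) \<kappa>_def L_def _ tail _ finP primeP])
        show "4 * exp (exp (40 * C) - 1) * Logt t powr ((exp (40 * C) - 1) / 2) \<le> b powr p0 * H"
          unfolding H_def using p0 by (intro mult_right_mono) auto
      qed (use small in auto)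
      then have "mupair f g \<psi> \<theta> E \<le> b powr p0 * H * (100 * exp C) ^ card {p \<in> P. real p \<le> p0}
          * (muset f \<psi> V * muset g \<theta> W * exp (- C * K)) powr \<kappa>"
        using sys unfolding mE mV mW edge_bound_def by blast
      moreover have "(100 * exp C) powr (p0 + real (card (Pset \<psi> \<theta> \<inter> {p. real p \<le> p0})))
          = b powr p0 * (100 * exp C) ^ card {p \<in> P. real p \<le> p0}"
      proof -
        have "Pset \<psi> \<theta> \<inter> {p. real p \<le> p0} = {p \<in> P. real p \<le> p0}" by (auto simp: P_def)
        then show ?thesis using b unfolding b_def[symmetric] by (simp add: powr_add powr_realpow)
      qed
      ultimately show ?thesis by (simp add: H_def \<kappa>_def mult_ac)
    qed
  qed
qed

end
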